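(* Let $G$ be a connected quantum graph with vertex set $V$, edge set $E$ and edge lengths $(L_e)_{e\in E}$, and let $\emptyset\neq V_{\mathrm o}\subseteq V$ be the set of outer vertices. Suppose that the family of edge lengths $(L_e)_{e\in E}$ is commensurable. Then there exists $L>0$ such that for all $$\lambda\in\left\{\left(\sqrt{\mu}+\frac{2\pi p}{L}\right)^2\colon\mu\in\left(0,\lambda_1(-\Delta_{V_{\mathrm o}})\right),\ p\in\mathbb N\right\}$$ one has $\lambda\notin\sigma(-\Delta_{V_{\mathrm o}})$ and the semigroup $(e^{-tD_{\lambda,V_{\mathrm o}}})_{t>0}$ is strongly positive.
   Context: Quantum graph. $G=(V,E)$ is a finite connected simple undirected graph (no loops, no parallel edges) with $E\neq\emptyset$, together with a length $L_e\in(0,\infty)$ for each $e\in E$. Each edge $e$ is identified with the interval $[0,L_e]$, one endpoint $e_{\mathrm l}$ of $e$ being identified with $0$ and the other endpoint $e_{\mathrm r}$ with $L_e$ (the choice of orientation is irrelevant). Functions are complex valued. $L^2(G)=\bigoplus_{e\in E}L^2([0,L_e])$. Commensurable. The family $(L_e)_{e\in E}$ is commensurable if there exist a family $(n_e)_{e\in E}$ in $\mathbb N=\{1,2,\dots\}$ and a number $L>0$ such that $n_eL=L_e$ for all $e\in E$. Maximal Laplacian. $D(\Delta_{\max})$ is the set of all $f=(f_e)_{e\in E}$ with $f_e\in H^2([0,L_e])$ for all $e$ that are continuous across vertices, i.e. $f_e(v)=f_{\tilde e}(v)$ whenever $e,\tilde e\in E$ both meet $v\in V$; $\Delta_{\max}f:=(f_e'')_{e\in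 E}$. The trace $\gamma f\in\mathbb C^V$ is $(\gamma f)(v):=$ the common value of $f$ at $v$. The outer normal derivative $\nu f\in\mathbb C^V$ is $(\nu f)(v):=-\sum_{e:\,e_{\mathrm l}=v}f_e'(0)+\sum_{e:\,e_{\mathrm r}=v}f_e'(L_e)$. Laplacian $\Delta_{V_{\mathrm o}}$. With $V_{\mathrm i}=V\setminus V_{\mathrm o}$, $\Delta_{V_{\mathrm o}}$ is the restriction of $\Delta_{\max}$ to $\{f\in D(\Delta_{\max})\colon(\gamma f)|_{V_{\mathrm o}}=0,\ (\nu f)|_{V_{\mathrm i}}=0\}$, an operator on $L^2(G)$; $-\Delta_{V_{\mathrm o}}$ is self-adjoint with compact resolvent and spectrum $\sigma(-\Delta_{V_{\mathrm o}})\subseteq(0,\infty)$, and $\lambda_1(-\Delta_{V_{\mathrm o}}):=\min\sigma(-\Delta_{V_{\mathrm o}})>0$. Dirichlet-to-Neumann operator. For $\lambda\in\mathbb R\setminus\sigma(-\Delta_{V_{\mathrm o}})$ and $x\in\mathbb C^{V_{\mathrm o}}$ there is a unique $f\in D(\Delta_{\max})$ with $\Delta_{\max}f+\lambda f=0$, $(\gamma f)|_{V_{\mathrm o}}=x$, $(\nu f)|_{V_{\mathrm i}}=0$; one sets $D_{\lambda,V_{\mathrm o}}x:=(\nu f)|_{V_{\mathrm o}}$. $D_{\lambda,V_{\mathrm o}}$ is identified with its matrix in the standard basis of $\mathbb C^{V_{\mathrm o}}$. The semigroup is strongly positive if all entries of the matrix $e^{-tD_{\lambda,V_{\mathrm o}}}$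 are $>0$ for all $t>0$. *)

theory Defs
  imports "HOL-Analysis.Analysis"
begin

section \<open>Quantum graphs\<close>

text \<open>
  An edge is the two-element set of its end points, so there are neither loops nor parallel
  edges. The fields \<open>lend\<close> and \<open>rend\<close> choose the orientation: the edge \<open>e\<close> is identified with
  \<open>{0..len G e}\<close>, the point \<open>0\<close> being \<open>lend G e\<close> and \<open>len G e\<close> being \<open>rend G e\<close>.
\<close>

record 'v quantum_graph =
  verts :: "'v set"
  edges :: "'v set set"
  len   :: "'v set \<Rightarrow> real"
  lend  :: "'v set \<Rightarrow> 'v"
  rend  :: "'v set \<Rightarrow> 'v"

locale connected_quantum_graph =
  fixes G :: "'v quantum_graph"
  assumes finite_verts: "finite (verts G)"
    and edges_nonempty: "edges G \<noteq> {}"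
    and edges_simple: "e \<in> edges G \<Longrightarrow> e \<subseteq> verts G \<and> card e = 2"
    and edge_ends: "e \<in> edges G \<Longrightarrow> e = {lend G e, rend G e}"
    and len_pos: "e \<in> edges G \<Longrightarrow> 0 < len G e"
    and connected: "\<lbrakk>u \<in> verts G; v \<in> verts G\<rbrakk> \<Longrightarrow> (u, v) \<in> {(a, b). {a, b} \<in> edges G}\<^sup>*"

definition commensurable :: "'i set \<Rightarrow> ('i \<Rightarrow> real) \<Rightarrow> bool" where
  "commensurable I l \<longleftrightarrow>
     (\<exists>(n :: 'i \<Rightarrow> nat) (L :: real). 0 < L \<and> (\<forall>i\<in>I. 1 \<le> n i \<and> real (n i) * L = l i))"


section \<open>Function spaces\<close>

text \<open>
  A function on the graph is a family \<open>f e x\<close>; only the values with \<open>e \<in> edges G\<close> and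
  \<open>x \<in> {0..len G e}\<close> matter. Elements of \<open>L\<^sup>2\<close> are given by representatives, and equality in
  \<open>L\<^sup>2\<close> is spelt out as equality almost everywhere.
\<close>

type_synonym 'v gfun = "'v set \<Rightarrow> real \<Rightarrow> complex"

definition L2_interval :: "real \<Rightarrow> (real \<Rightarrow> complex) set" where
  "L2_interval l =
     {f. f \<in> borel_measurable (lebesgue_on {0..l}) \<and>
         integrable (lebesgue_on {0..l}) (\<lambda>x. (cmod (f x))\<^sup>2)}"

definition L2_graph :: "'v quantum_graph \<Rightarrow> 'v gfun set" where
  "L2_graph G = {f. \<forall>e\<in>edges G. f e \<in> L2_interval (len G e)}"

definition L2_norm :: "'v quantum_graph \<Rightarrow> 'v gfun \<Rightarrow> real" where
  "L2_norm G f = sqrt (\<Sum>e\<in>edges G. LINT x|lebesgue_on {0..len G e}. (cmod (f e x))\<^sup>2)"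

definition L2_eq :: "'v quantum_graph \<Rightarrow> 'v gfun \<Rightarrow> 'v gfun \<Rightarrow> bool" where
  "L2_eq G f g \<longleftrightarrow> (\<forall>e\<in>edges G. AE x in lebesgue_on {0..len G e}. f e x = g e x)"

text \<open>
  \<open>H1_deriv l f g\<close>: \<open>f\<close> is the absolutely continuous representative of an element of
  \<open>H\<^sup>1([0,l])\<close>, and \<open>g\<close> represents its derivative in \<open>L\<^sup>2\<close>.
  \<open>H2_deriv2 l f g\<close>: \<open>f\<close> is the \<open>C\<^sup>1\<close> representative of an element of \<open>H\<^sup>2([0,l])\<close>, and \<open>g\<close>
  represents \<open>f''\<close>. Here the witness \<open>h\<close> is absolutely continuous and is the classical
  derivative of \<open>f\<close> (one-sided at the end points).
\<close>

definition H1_deriv :: "real \<Rightarrow> (real \<Rightarrow> complex) \<Rightarrow> (real \<Rightarrow> complex) \<Rightarrow> bool" where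
  "H1_deriv l f g \<longleftrightarrow>
     g \<in> L2_interval l \<and> (\<forall>x\<in>{0..l}. f x = f 0 + (LINT t|lebesgue_on {0..x}. g t))"

definition H2_deriv2 :: "real \<Rightarrow> (real \<Rightarrow> complex) \<Rightarrow> (real \<Rightarrow> complex) \<Rightarrow> bool" where
  "H2_deriv2 l f g \<longleftrightarrow> (\<exists>h. H1_deriv l f h \<and> H1_deriv l h g)"


section \<open>The maximal Laplacian, trace and outer normal derivative\<close>

definition vertex_value :: "'v quantum_graph \<Rightarrow> 'v gfun \<Rightarrow> 'v set \<Rightarrow> 'v \<Rightarrow> complex" where
  "vertex_value G f e v = (if v = lend G e then f e 0 else f e (len G e))"

definition continuous_across_vertices :: "'v quantum_graph \<Rightarrow> 'v gfun \<Rightarrow> bool" where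
  "continuous_across_vertices G f \<longleftrightarrow>
     (\<forall>v\<in>verts G. \<forall>e\<in>edges G. \<forall>e'\<in>edges G. v \<in> e \<longrightarrow> v \<in> e' \<longrightarrow>
        vertex_value G f e v = vertex_value G f e' v)"

text \<open>
  Operators in \<open>L\<^sup>2(G)\<close> are given by their graphs: \<open>(f, g) \<in> A\<close> means that \<open>f\<close> is in the domain
  of \<open>A\<close> and that \<open>g\<close> is a representative of \<open>A f\<close>.
\<close>

definition Delta_max :: "'v quantum_graph \<Rightarrow> ('v gfun \<times> 'v gfun) set" where
  "Delta_max G =
     {(f, g). (\<forall>e\<in>edges G. H2_deriv2 (len G e) (f e) (g e)) \<and> continuous_across_vertices G f}"

definition vertex_trace :: "'v quantum_graph \<Rightarrow> 'v gfun \<Rightarrow> 'v \<Rightarrow> complex" where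
  "vertex_trace G f v = (THE c. \<forall>e\<in>edges G. v \<in> e \<longrightarrow> vertex_value G f e v = c)"

definition normal_deriv :: "'v quantum_graph \<Rightarrow> 'v gfun \<Rightarrow> 'v \<Rightarrow> complex" where
  "normal_deriv G f v =
     - (\<Sum>e\<in>{e \<in> edges G. lend G e = v}. vector_derivative (f e) (at 0 within {0..len G e}))
     + (\<Sum>e\<in>{e \<in> edges G. rend G e = v}.
          vector_derivative (f e) (at (len G e) within {0..len G e}))"

definition Delta :: "'v quantum_graph \<Rightarrow> 'v set \<Rightarrow> ('v gfun \<times> 'v gfun) set" where
  "Delta G Vo =
     {(f, g). (f, g) \<in> Delta_max G \<and> (\<forall>v\<in>Vo. vertex_trace G f v = 0) \<and>
              (\<forall>v\<in>verts G - Vo. normal_deriv G f v = 0)}"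

definition neg_op :: "('v gfun \<times> 'v gfun) set \<Rightarrow> ('v gfun \<times> 'v gfun) set" where
  "neg_op A = {(f, \<lambda>e x. - g e x) | f g. (f, g) \<in> A}"


section \<open>Spectrum\<close>

text \<open>
  \<open>z\<close> is in the resolvent set iff \<open>z - A\<close> is a bijection from the domain of \<open>A\<close> onto \<open>L\<^sup>2(G)\<close>
  with bounded inverse; the three conjuncts are injectivity, surjectivity and boundedness of
  the inverse.
\<close>

definition resolvent_set :: "'v quantum_graph \<Rightarrow> ('v gfun \<times> 'v gfun) set \<Rightarrow> complex set" where
  "resolvent_set G A =
     {z. (\<forall>(f, g)\<in>A. L2_eq G (\<lambda>e x. z * f e x - g e x) (\<lambda>e x. 0) \<longrightarrow> L2_eq G f (\<lambda>e x. 0)) \<and>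
         (\<forall>h\<in>L2_graph G. \<exists>(f, g)\<in>A. L2_eq G (\<lambda>e x. z * f e x - g e x) h) \<and>
         (\<exists>C. \<forall>(f, g)\<in>A. L2_norm G f \<le> C * L2_norm G (\<lambda>e x. z * f e x - g e x))}"

definition spectrum :: "'v quantum_graph \<Rightarrow> ('v gfun \<times> 'v gfun) set \<Rightarrow> complex set" where
  "spectrum G A = - resolvent_set G A"

definition lambda1 :: "'v quantum_graph \<Rightarrow> 'v set \<Rightarrow> real" where
  "lambda1 G Vo = (LEAST \<mu>. complex_of_real \<mu> \<in> spectrum G (neg_op (Delta G Vo)))"


section \<open>The Dirichlet-to-Neumann operator and its semigroup\<close>

definition DtN_solution ::
    "'v quantum_graph \<Rightarrow> 'v set \<Rightarrow> real \<Rightarrow> ('v \<Rightarrow> complex) \<Rightarrow> 'v gfun \<Rightarrow> bool" where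
  "DtN_solution G Vo lam x f \<longleftrightarrow>
     (\<exists>g. (f, g) \<in> Delta_max G \<and>
          L2_eq G (\<lambda>e t. g e t + complex_of_real lam * f e t) (\<lambda>e t. 0)) \<and>
     (\<forall>v\<in>Vo. vertex_trace G f v = x v) \<and> (\<forall>v\<in>verts G - Vo. normal_deriv G f v = 0)"

text \<open>
  The solution is unique only as a family of functions on the edges, not as a \<open>gfun\<close> (whose
  values off the edges are arbitrary), hence the description of the value instead of the solution.
\<close>

definition DtN :: "'v quantum_graph \<Rightarrow> 'v set \<Rightarrow> real \<Rightarrow> ('v \<Rightarrow> complex) \<Rightarrow> 'v \<Rightarrow> complex" where
  "DtN G Vo lam x v = (THE c. \<exists>f. DtN_solution G Vo lam x f \<and> c = normal_deriv G f v)"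

text \<open>
  Matrices with rows and columns indexed by a finite set \<open>S\<close> are functions \<open>M u v\<close> with row index
  \<open>u\<close> and column index \<open>v\<close>; only the entries with \<open>u, v \<in> S\<close> matter.
\<close>

definition DtN_matrix :: "'v quantum_graph \<Rightarrow> 'v set \<Rightarrow> real \<Rightarrow> 'v \<Rightarrow> 'v \<Rightarrow> complex" where
  "DtN_matrix G Vo lam u v = DtN G Vo lam (\<lambda>w. if w = v then 1 else 0) u"

primrec matrix_pow :: "'v set \<Rightarrow> ('v \<Rightarrow> 'v \<Rightarrow> complex) \<Rightarrow> nat \<Rightarrow> 'v \<Rightarrow> 'v \<Rightarrow> complex" where
  "matrix_pow S M 0 = (\<lambda>u v. if u = v then 1 else 0)"
| "matrix_pow S M (Suc k) = (\<lambda>u v. \<Sum>w\<in>S. M u w * matrix_pow S M k w v)"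

definition matrix_exp :: "'v set \<Rightarrow> ('v \<Rightarrow> 'v \<Rightarrow> complex) \<Rightarrow> 'v \<Rightarrow> 'v \<Rightarrow> complex" where
  "matrix_exp S M u v = (\<Sum>k. matrix_pow S M k u v / fact k)"

definition DtN_semigroup :: "'v quantum_graph \<Rightarrow> 'v set \<Rightarrow> real \<Rightarrow> real \<Rightarrow> 'v \<Rightarrow> 'v \<Rightarrow> complex" where
  "DtN_semigroup G Vo lam t =
     matrix_exp Vo (\<lambda>u v. - complex_of_real t * DtN_matrix G Vo lam u v)"

definition strongly_positive :: "'v set \<Rightarrow> (real \<Rightarrow> 'v \<Rightarrow> 'v \<Rightarrow> complex) \<Rightarrow> bool" where
  "strongly_positive S T \<longleftrightarrow>
     (\<forall>t>0. \<forall>u\<in>S. \<forall>v\<in>S. T t u v \<in> \<real> \<and> 0 < Re (T t u v))"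

end

theory Submission
  imports Defs "HOL-Real_Asymp.Real_Asymp"
begin

text \<open>
  Write \<open>C\<^sub>e\<close>, \<open>S\<^sub>e\<close> for the values at \<open>len G e\<close> of the solutions of \<open>u'' = - lam u\<close> with Cauchy data
  \<open>(1, 0)\<close> and \<open>(0, 1)\<close> at \<open>0\<close>. If no \<open>S\<^sub>e\<close> vanishes, a solution on the graph is determined by its
  vertex values \<open>y\<close>, and its outer normal derivative at \<open>v\<close> is
  \<open>vertex_op G lam y v = (\<Sum>e \<ni> v. (C\<^sub>e y\<^sub>v - y\<^sub>w) / S\<^sub>e)\<close>, where \<open>w\<close> is the other end of \<open>e\<close>. The spectral
  problem and the Dirichlet-to-Neumann operator thus become statements about a finite matrix, and \<open>lam\<close>
  enters only through the numbers \<open>C\<^sub>e\<close> and \<open>S\<^sub>e\<close>.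

  Shifting \<open>sqrt lam\<close> by \<open>2 \<pi> p / L\<close>, where all lengths are integer multiples of \<open>L\<close>, changes the angles
  \<open>sqrt lam * len G e\<close> by multiples of \<open>2 \<pi>\<close>. Hence all \<open>C\<^sub>e\<close> stay the same, all \<open>S\<^sub>e\<close> are multiplied by one
  positive factor, and the whole matrix is multiplied by a positive factor (\<open>admissible_shift\<close>). So it
  suffices to find, for \<open>0 < \<mu> < lambda1\<close>, a property of the matrix which is invariant under positive
  scaling and implies both conclusions. This property is \<open>admissible\<close>: all \<open>S\<^sub>e\<close> are positive, so that
  off-diagonal entries are not positive, and there is a vector, positive on the inner vertices and zero
  on the outer ones, that \<open>vertex_op\<close> maps to a vector positive on the inner vertices. This is the classical
  characterisation of nonsingular M-matrices, for the inner block.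

  Admissibility yields a maximum principle (\<open>comparison\<close>), hence unique solvability with bounds, and
  Duhamel's formula carries this over to the resolvent (\<open>admissible_imp_resolvent\<close>). The maximum principle
  also gives the signs of the Dirichlet-to-Neumann matrix: off-diagonal entries are not positive, and
  connectedness of the graph makes the matrix irreducible. The exponential of the negative of such a matrix
  has positive entries (\<open>admissible_imp_strongly_positive\<close>).

  It remains to see that every \<open>\<mu> < lambda1\<close> is admissible. Negative parameters are admissible, and
  admissibility is an open condition. Let \<open>ls\<close> be the infimum of the parameters that are not admissible;
  then \<open>ls\<close> itself is not admissible. If all \<open>S\<^sub>e\<close> are positive at \<open>ls\<close>, the inner block must be singular,
  for otherwise the solution of \<open>vertex_op x = 1\<close> would be nonnegative, by the maximum principle for
  parameters slightly below \<open>ls\<close>, and would witness admissibility. If some \<open>S\<^sub>e\<close> vanishes at \<open>ls\<close>, a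
  diagonal entry would be negative just below \<open>ls\<close> if \<open>e\<close> had an inner end point; so both ends are outer and
  a sine on \<open>e\<close> is an eigenfunction. In both cases \<open>ls\<close> is in the spectrum, and everything below \<open>ls\<close> is in
  the resolvent set, so \<open>ls = lambda1\<close> (\<open>spectrum_bottom\<close>).
\<close>


section \<open>The fundamental solutions on an edge\<close>

text \<open>The solutions of \<open>u'' = - lam u\<close> with \<open>u 0 = 1, u' 0 = 0\<close> and \<open>u 0 = 0, u' 0 = 1\<close>. They are entire functions of \<open>lam\<close>,
  written here by the sign of \<open>lam\<close>; parameters of every sign occur because \<open>lambda1\<close> is the least real number
  in the spectrum.\<close>

definition cos_sol :: "real \<Rightarrow> real \<Rightarrow> real" where
  "cos_sol lam x = (if 0 \<le> lam then cos (sqrt lam * x) else cosh (sqrt (- lam) * x))"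

definition sin_sol :: "real \<Rightarrow> real \<Rightarrow> real" where
  "sin_sol lam x =
     (if 0 < lam then sin (sqrt lam * x) / sqrt lam
      else if lam = 0 then x else sinh (sqrt (- lam) * x) / sqrt (- lam))"

lemma cos_sol_0 [simp]: "cos_sol lam 0 = 1" and sin_sol_0 [simp]: "sin_sol lam 0 = 0"
  by (auto simp: cos_sol_def sin_sol_def)

lemma has_field_derivative_cos_sol [derivative_intros]:
  assumes "(f has_field_derivative f') (at x within A)"
  shows "((\<lambda>x. cos_sol lam (f x)) has_field_derivative - lam * sin_sol lam (f x) * f') (at x within A)"
proof -
  have "(cos_sol lam has_field_derivative - lam * sin_sol lam y) (at y)" for y
  proof -
    consider "lam > 0" | "lam = 0" | "lam < 0" by linarith
    then show ?thesis
    proof cases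
      case 1
      have "cos_sol lam = (\<lambda>x. cos (sqrt lam * x))" using 1 by (auto simp: cos_sol_def)
      moreover have "((\<lambda>x. cos (sqrt lam * x)) has_field_derivative - sin (sqrt lam * y) * sqrt lam) (at y)"
        by (auto intro!: derivative_eq_intros)
      moreover have "- sin (sqrt lam * y) * sqrt lam = - lam * sin_sol lam y"
        using 1 real_sqrt_mult_self[of lam] by (auto simp: sin_sol_def field_simps simp del: real_sqrt_mult_self)
      ultimately show ?thesis by simp
    next
      case 2
      have "cos_sol lam = (\<lambda>x. 1)" using 2 by (auto simp: cos_sol_def)
      then show ?thesis using 2 by simp
    next
      case 3
      have "cos_sol lam = (\<lambda>x. cosh (sqrt (- lam) * x))" using 3 by (auto simp: cos_sol_def)
      moreover have "((\<lambda>x. cosh (sqrt (- lam) * x)) has_field_derivative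
          sinh (sqrt (- lam) * y) * sqrt (- lam)) (at y)"
        by (auto intro!: derivative_eq_intros)
      moreover have "sqrt (- lam) * sqrt (- lam) = - lam" using 3 by (intro real_sqrt_mult_self[THEN trans]) simp
      then have "sinh (sqrt (- lam) * y) * sqrt (- lam) = - lam * sin_sol lam y"
        using 3 by (simp add: sin_sol_def divide_simps mult.assoc)
      ultimately show ?thesis by simp
    qed
  qed
  from DERIV_chain'[OF assms this] show ?thesis by (simp add: mult.commute)
qed

lemma has_field_derivative_sin_sol [derivative_intros]:
  assumes "(f has_field_derivative f') (at x within A)"
  shows "((\<lambda>x. sin_sol lam (f x)) has_field_derivative cos_sol lam (f x) * f') (at x within A)"
proof -
  have "(sin_sol lam has_field_derivative cos_sol lam y) (at y)" for y
  proof -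
    consider "lam > 0" | "lam = 0" | "lam < 0" by linarith
    then show ?thesis
    proof cases
      case 1
      have "sin_sol lam = (\<lambda>x. sin (sqrt lam * x) / sqrt lam)" using 1 by (auto simp: sin_sol_def)
      then show ?thesis using 1 by (auto intro!: derivative_eq_intros simp: cos_sol_def mult.assoc)
    next
      case 2
      have "sin_sol lam = (\<lambda>x. x)" using 2 by (auto simp: sin_sol_def)
      then show ?thesis using 2 by (auto simp: cos_sol_def)
    next
      case 3
      have "sin_sol lam = (\<lambda>x. sinh (sqrt (- lam) * x) / sqrt (- lam))"
        using 3 by (auto simp: sin_sol_def)
      then show ?thesis using 3 by (auto intro!: derivative_eq_intros simp: cos_sol_def mult.assoc)
    qed
  qed
  from DERIV_chain'[OF assms this] show ?thesis by (simp add: mult.commute)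
qed

lemma continuous_on_cos_sol [continuous_intros]:
  assumes "continuous_on A f" shows "continuous_on A (\<lambda>x. cos_sol lam (f x))"
  and continuous_on_sin_sol [continuous_intros]:  "continuous_on A (\<lambda>x. sin_sol lam (f x))"
proof -
  have "continuous_on UNIV (cos_sol lam)"
    by (rule DERIV_continuous_on) (auto intro!: derivative_eq_intros)
  from continuous_on_compose2[OF this assms] show "continuous_on A (\<lambda>x. cos_sol lam (f x))" by simp
  have "continuous_on UNIV (sin_sol lam)"
    by (rule DERIV_continuous_on) (auto intro!: derivative_eq_intros)
  from continuous_on_compose2[OF this assms] show "continuous_on A (\<lambda>x. sin_sol lam (f x))" by simp
qed

text \<open>The Wronskian of the two solutions.\<close>

lemma cos_sol_sin_sol_squares: "(cos_sol lam x)\<^sup>2 + lam * (sin_sol lam x)\<^sup>2 = 1"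
proof -
  consider "lam > 0" | "lam = 0" | "lam < 0" by linarith
  then show ?thesis
    by cases (auto simp: cos_sol_def sin_sol_def power_divide cosh_square_eq)
qed

text \<open>Continuity in the parameter, across \<open>lam = 0\<close> in particular, is what lets the bottom of the spectrum be found as
  an infimum.\<close>

lemma isCont_cos_sol_param: "isCont (\<lambda>lam. cos_sol lam x) lam"
proof -
  have l: "((\<lambda>lam. cos_sol lam x) \<longlongrightarrow> cosh (sqrt (- lam) * x)) (at_left lam)" if "lam \<le> 0"
  proof -
    have "((\<lambda>lam. cosh (sqrt (- lam) * x)) \<longlongrightarrow> cosh (sqrt (- lam) * x)) (at_left lam)"
      by (intro tendsto_intros)
    moreover have "\<forall>\<^sub>F t in at_left lam. cosh (sqrt (- t) * x) = cos_sol t x"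
      using that by (auto simp: eventually_at_filter cos_sol_def)
    ultimately show ?thesis by (rule Lim_transform_eventually)
  qed
  have r: "((\<lambda>lam. cos_sol lam x) \<longlongrightarrow> cos (sqrt lam * x)) (at_right lam)" if "lam \<ge> 0"
  proof -
    have "((\<lambda>lam. cos (sqrt lam * x)) \<longlongrightarrow> cos (sqrt lam * x)) (at_right lam)"
      by (intro tendsto_intros)
    moreover have "\<forall>\<^sub>F t in at_right lam. cos (sqrt t * x) = cos_sol t x"
      using that by (auto simp: eventually_at_filter cos_sol_def)
    ultimately show ?thesis by (rule Lim_transform_eventually)
  qed
  consider "lam > 0" | "lam = 0" | "lam < 0" by linarith
  then show ?thesis
  proof cases
    case 1
    have "isCont (\<lambda>lam. cos (sqrt lam * x)) lam" by (intro continuous_intros)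
    moreover have "\<forall>\<^sub>F t in nhds lam. cos (sqrt t * x) = cos_sol t x"
      using eventually_nhds_in_open[of "{0<..}" lam] 1 by (auto simp: cos_sol_def elim!: eventually_mono)
    ultimately show ?thesis using isCont_cong by force
  next
    case 2
    then show ?thesis using l r by (auto simp: isCont_def filterlim_at_split cos_sol_def)
  next
    case 3
    have "isCont (\<lambda>lam. cosh (sqrt (- lam) * x)) lam" by (intro continuous_intros)
    moreover have "\<forall>\<^sub>F t in nhds lam. cosh (sqrt (- t) * x) = cos_sol t x"
      using eventually_nhds_in_open[of "{..<0}" lam] 3 by (auto simp: cos_sol_def elim!: eventually_mono)
    ultimately show ?thesis using isCont_cong by force
  qed
qed

lemma isCont_sin_sol_param: "isCont (\<lambda>lam. sin_sol lam x) lam"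
proof -
  consider "lam > 0" | "lam = 0" | "lam < 0" by linarith
  then show ?thesis
  proof cases
    case 1
    then have "isCont (\<lambda>lam. sin (sqrt lam * x) / sqrt lam) lam" by (intro continuous_intros) auto
    moreover have "\<forall>\<^sub>F t in nhds lam. sin (sqrt t * x) / sqrt t = sin_sol t x"
      using eventually_nhds_in_open[of "{0<..}" lam] 1 by (auto simp: sin_sol_def elim!: eventually_mono)
    ultimately show ?thesis using isCont_cong by force
  next
    case 2
    have "((\<lambda>t. sin (sqrt t * x) / sqrt t) \<longlongrightarrow> x) (at_right 0)" by real_asymp
    moreover have "\<forall>\<^sub>F t in at_right 0. sin (sqrt t * x) / sqrt t = sin_sol t x"
      by (auto simp: eventually_at_filter sin_sol_def)
    ultimately have r: "((\<lambda>t. sin_sol t x) \<longlongrightarrow> x) (at_right 0)" by (rule Lim_transform_eventually)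
    have "((\<lambda>t. sinh (sqrt (- t) * x) / sqrt (- t)) \<longlongrightarrow> x) (at_left 0)"
      unfolding sinh_field_def by real_asymp
    moreover have "\<forall>\<^sub>F t in at_left 0. sinh (sqrt (- t) * x) / sqrt (- t) = sin_sol t x"
      by (auto simp: eventually_at_filter sin_sol_def)
    ultimately have l: "((\<lambda>t. sin_sol t x) \<longlongrightarrow> x) (at_left 0)" by (rule Lim_transform_eventually)
    show ?thesis using l r 2 by (auto simp: isCont_def filterlim_at_split sin_sol_def)
  next
    case 3
    then have "isCont (\<lambda>lam. sinh (sqrt (- lam) * x) / sqrt (- lam)) lam" by (intro continuous_intros) auto
    moreover have "\<forall>\<^sub>F t in nhds lam. sinh (sqrt (- t) * x) / sqrt (- t) = sin_sol t x"
      using eventually_nhds_in_open[of "{..<0}" lam] 3 by (auto simp: sin_sol_def elim!: eventually_mono)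
    ultimately show ?thesis using isCont_cong by force
  qed
qed


section \<open>Square linear systems\<close>

text \<open>Gaussian elimination, one equation at a time. The index types are arbitrary, which is why the systems on
  the vertex set of a graph need no enumeration of the vertices.\<close>

lemma homogeneous_system_nontrivial_solution:
  fixes a :: "'i \<Rightarrow> 'j \<Rightarrow> 'a::field"
  assumes "finite I" "finite J" "card I < card J"
  shows "\<exists>y. (\<exists>j\<in>J. y j \<noteq> 0) \<and> (\<forall>i\<in>I. (\<Sum>j\<in>J. a i j * y j) = 0)"
  using assms
proof (induction I arbitrary: J a rule: finite_induct)
  case empty
  then obtain j where "j \<in> J" by (metis card_gt_0_iff ex_in_conv card.empty)
  then show ?case by (intro exI[of _ "\<lambda>_. 1"]) auto
next
  case (insert k I)
  show ?case
  proof (cases "\<forall>j\<in>J. a k j = 0")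
    case True
    with insert.IH[of J a] insert.prems insert.hyps show ?thesis by auto
  next
    case False
    \<comment> \<open>The unknown \<open>p\<close> is the pivot: equation \<open>k\<close> eliminates it from the other equations.\<close>
    then obtain p where p: "p \<in> J" "a k p \<noteq> 0" by auto
    define a' where "a' i j = a i j - a i p / a k p * a k j" for i j
    have "card I < card (J - {p})" using insert p by auto
    with insert.IH[of "J - {p}" a'] insert.prems obtain y where
      y: "\<exists>j\<in>J - {p}. y j \<noteq> 0" "\<And>i. i \<in> I \<Longrightarrow> (\<Sum>j\<in>J - {p}. a' i j * y j) = 0" by auto
    define s where "s = (\<Sum>j\<in>J - {p}. a k j * y j)"
    define z where "z = y(p := - s / a k p)"
    have sum_z: "(\<Sum>j\<in>J. a i j * z j) = a i p * (- s / a k p) + (\<Sum>j\<in>J - {p}. a i j * y j)" for i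
      using insert.prems p by (simp add: sum.remove[of J p] z_def)
    have "(\<Sum>j\<in>J. a i j * z j) = 0" if "i \<in> insert k I" for i
    proof (cases "i = k")
      case True
      then show ?thesis using p unfolding sum_z by (simp add: s_def)
    next
      case False
      with that have "0 = (\<Sum>j\<in>J - {p}. a' i j * y j)" using y(2) by simp
      also have "\<dots> = (\<Sum>j\<in>J - {p}. a i j * y j) - a i p / a k p * s"
        by (simp add: a'_def s_def algebra_simps sum_subtractf sum_distrib_left)
      finally show ?thesis unfolding sum_z by simp
    qed
    moreover have "\<exists>j\<in>J. z j \<noteq> 0" using y(1) by (auto simp: z_def)
    ultimately show ?thesis by blast
  qed
qed

text \<open>Treat the right-hand side as one more column, indexed by \<open>None\<close>: the enlarged homogeneous system has a
  nontrivial solution, and injectivity forces its \<open>None\<close> component to be nonzero, so it can be normalised.\<close>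

lemma injective_system_solvable:
  fixes a :: "'i \<Rightarrow> 'i \<Rightarrow> 'a::field"
  assumes fin: "finite I"
    and inj: "\<And>y. (\<And>i. i \<in> I \<Longrightarrow> (\<Sum>j\<in>I. a i j * y j) = 0) \<Longrightarrow> \<forall>i\<in>I. y i = 0"
  shows "\<exists>y. \<forall>i\<in>I. (\<Sum>j\<in>I. a i j * y j) = b i"
proof -
  define c where "c i j = (case j of None \<Rightarrow> - b i | Some j \<Rightarrow> a i j)" for i j
  let ?J = "insert None (Some ` I)"
  have "card I < card ?J" using fin by (simp add: card_image)
  from homogeneous_system_nontrivial_solution[of I ?J c, OF fin _ this] fin obtain z where
    z: "\<exists>j\<in>?J. z j \<noteq> 0" "\<And>i. i \<in> I \<Longrightarrow> (\<Sum>j\<in>?J. c i j * z j) = 0" by auto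
  have eq: "(\<Sum>j\<in>I. a i j * z (Some j)) = b i * z None" if "i \<in> I" for i
  proof -
    have "(\<Sum>j\<in>?J. c i j * z j) = - b i * z None + (\<Sum>j\<in>I. a i j * z (Some j))"
      using fin by (simp add: c_def sum.reindex)
    with z(2)[OF that] show ?thesis by (simp add: algebra_simps add_eq_0_iff)
  qed
  have "z None \<noteq> 0"
  proof
    assume "z None = 0"
    with inj[of "\<lambda>j. z (Some j)"] eq have "\<forall>i\<in>I. z (Some i) = 0" by simp
    with z(1) \<open>z None = 0\<close> show False by auto
  qed
  with eq have "\<forall>i\<in>I. (\<Sum>j\<in>I. a i j * (z (Some j) / z None)) = b i"
    by (simp flip: sum_divide_distrib add: times_divide_eq_right)
  then show ?thesis by (intro exI[of _ "\<lambda>j. z (Some j) / z None"])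
qed


section \<open>Matrix exponentials\<close>

lemma norm_matrix_pow_le:
  assumes S: "finite S" and K: "\<And>w. w \<in> S \<Longrightarrow> (\<Sum>z\<in>S. cmod (M w z)) \<le> K" and K0: "0 \<le> K"
    and u: "u \<in> S"
  shows "cmod (matrix_pow S M k u v) \<le> K ^ k"
  using u
proof (induction k arbitrary: u)
  case (Suc k)
  have "cmod (matrix_pow S M (Suc k) u v) \<le> (\<Sum>w\<in>S. cmod (M u w) * cmod (matrix_pow S M k w v))"
    using norm_sum[of "\<lambda>w. M u w * matrix_pow S M k w v" S] by (simp add: norm_mult)
  also have "\<dots> \<le> (\<Sum>w\<in>S. cmod (M u w) * K ^ k)"
    by (intro sum_mono mult_left_mono Suc.IH) auto
  also have "\<dots> = (\<Sum>w\<in>S. cmod (M u w)) * K ^ k" by (simp add: sum_distrib_right)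
  also have "\<dots> \<le> K * K ^ k" by (intro mult_right_mono K Suc.prems) (use K0 in auto)
  finally show ?case by simp
qed auto

lemma summable_norm_matrix_exp:
  assumes S: "finite S" and u: "u \<in> S"
  shows "summable (\<lambda>k. cmod (matrix_pow S M k u v / fact k))"
proof -
  define K where "K = (\<Sum>w\<in>S. \<Sum>z\<in>S. cmod (M w z))"
  have K0: "0 \<le> K" by (auto simp: K_def intro!: sum_nonneg)
  have "(\<Sum>z\<in>S. cmod (M w z)) \<le> K" if "w \<in> S" for w
    unfolding K_def by (rule member_le_sum[OF that _ S]) (rule sum_nonneg, rule norm_ge_zero)
  from norm_matrix_pow_le[OF S this K0 u] have le: "cmod (matrix_pow S M k u v) \<le> K ^ k" for k .
  show ?thesis
  proof (rule summable_comparison_test')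
    show "summable (\<lambda>k. inverse (fact k) * K ^ k)" by (rule summable_exp)
    show "norm (cmod (matrix_pow S M k u v / fact k)) \<le> inverse (fact k) * K ^ k" if "0 \<le> k" for k
    proof -
      have "norm (cmod (matrix_pow S M k u v / fact k)) = cmod (matrix_pow S M k u v) / fact k"
        by (simp add: norm_divide)
      also have "\<dots> \<le> K ^ k / fact k" by (intro divide_right_mono le) simp
      finally show ?thesis by (simp only: divide_inverse mult.commute)
    qed
  qed
qed

text \<open>The binomial theorem, valid because the scalar matrix \<open>c\<close> commutes with \<open>M\<close>.\<close>

lemma matrix_pow_add_scalar:
  assumes S: "finite S" and u: "u \<in> S"
  shows "matrix_pow S (\<lambda>u v. M u v + (if u = v then c else 0)) n u v =
    (\<Sum>k\<le>n. of_nat (n choose k) * c ^ (n - k) * matrix_pow S M k u v)"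
  using u
proof (induction n arbitrary: u)
  case (Suc n)
  let ?P = "\<lambda>k. matrix_pow S M k"
  let ?b = "\<lambda>n k. of_nat (n choose k) * c ^ (n - k) :: complex"
  let ?X = "\<Sum>k\<le>Suc n. (if k = 0 then 0 else ?b n (k - 1)) * ?P k u v"
    and ?Y = "\<Sum>k\<le>Suc n. (if k = Suc n then 0 else c * ?b n k) * ?P k u v"
  have "(\<Sum>w\<in>S. M u w * (\<Sum>k\<le>n. ?b n k * ?P k w v)) = (\<Sum>k\<le>n. ?b n k * ?P (Suc k) u v)"
    unfolding sum_distrib_left matrix_pow.simps by (subst sum.swap) (simp only: mult.left_commute)
  also have "\<dots> = (\<Sum>k=1..Suc n. ?b n (k - 1) * ?P k u v)"
    by (rule sum.reindex_bij_witness[of _ "\<lambda>k. k - 1" Suc]) auto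
  also have "\<dots> = ?X" by (rule sum.mono_neutral_cong_left) auto
  finally have X: "(\<Sum>w\<in>S. M u w * (\<Sum>k\<le>n. ?b n k * ?P k w v)) = ?X" .
  have Y: "c * (\<Sum>k\<le>n. ?b n k * ?P k u v) = ?Y"
    unfolding sum_distrib_left by (rule sum.mono_neutral_cong_left) (auto simp: mult.assoc)
  have "matrix_pow S (\<lambda>u v. M u v + (if u = v then c else 0)) (Suc n) u v
      = (\<Sum>w\<in>S. (M u w + (if u = w then c else 0)) * (\<Sum>k\<le>n. ?b n k * ?P k w v))"
    unfolding matrix_pow.simps by (rule sum.cong[OF refl]) (simp only: Suc.IH)
  also have "\<dots> = (\<Sum>w\<in>S. M u w * (\<Sum>k\<le>n. ?b n k * ?P k w v)) + c * (\<Sum>k\<le>n. ?b n k * ?P k u v)"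
  proof -
    have "(M u w + (if u = w then c else 0)) * x = M u w * x + (if u = w then c * x else 0)" for w x
      by (simp add: distrib_right)
    then show ?thesis using S Suc.prems by (simp only: sum.distrib sum.delta' if_True)
  qed
  also have "\<dots> = ?X + ?Y" unfolding X Y ..
  also have "\<dots> = (\<Sum>k\<le>Suc n. ?b (Suc n) k * ?P k u v)"
    unfolding sum.distrib[symmetric]
  proof (rule sum.cong[OF refl])
    fix k assume "k \<in> {..Suc n}"
    then have "(if k = 0 then 0 else ?b n (k - 1)) + (if k = Suc n then 0 else c * ?b n k) = ?b (Suc n) k"
    proof (cases k)
      case (Suc m)
      show ?thesis
      proof (cases "m = n")
        case False
        with Suc \<open>k \<in> {..Suc n}\<close> have "n - m = Suc (n - Suc m)" by auto
        then have "c ^ (n - m) = c * c ^ (n - Suc m)" by (simp only: power_Suc)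
        with False show ?thesis unfolding Suc by (simp add: distrib_right distrib_left mult.assoc mult.left_commute)
      next
        case True
        then show ?thesis unfolding Suc by simp
      qed
    next
      case 0
      then show ?thesis by simp
    qed
    then show "(if k = 0 then 0 else ?b n (k - 1)) * ?P k u v
        + (if k = Suc n then 0 else c * ?b n k) * ?P k u v = ?b (Suc n) k * ?P k u v"
      by (simp only: distrib_right[symmetric])
  qed
  finally show ?case .
qed auto

text \<open>The Cauchy product of the two exponential series has the binomial expansion as its coefficients.\<close>

lemma matrix_exp_add_scalar:
  assumes S: "finite S" and u: "u \<in> S"
  shows "matrix_exp S (\<lambda>u v. M u v + (if u = v then c else 0)) u v = exp c * matrix_exp S M u v"
proof -
  let ?a = "\<lambda>k. matrix_pow S M k u v / fact k" and ?e = "\<lambda>k. c ^ k / fact k"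
  have e: "?e = (\<lambda>k. c ^ k /\<^sub>R fact k)"
    by (simp add: fun_eq_iff scaleR_conv_of_real field_simps)
  have "summable (\<lambda>k. cmod (?e k))" 
    using summable_norm_exp[of c] by (simp only: e[THEN fun_cong])
  from Cauchy_product_sums[OF summable_norm_matrix_exp[OF S u] this]
  have "(\<lambda>n. \<Sum>k\<le>n. ?a k * ?e (n - k)) sums ((\<Sum>k. ?a k) * (\<Sum>k. ?e k))" .
  also have "(\<lambda>n. \<Sum>k\<le>n. ?a k * ?e (n - k)) =
      (\<lambda>n. matrix_pow S (\<lambda>u v. M u v + (if u = v then c else 0)) n u v / fact n)"
    by (auto simp: fun_eq_iff matrix_pow_add_scalar[OF S u] sum_divide_distrib binomial_fact
        field_simps intro!: sum.cong)
  also have "(\<Sum>k. ?e k) = exp c" unfolding e by (simp add: exp_def)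
  finally show ?thesis unfolding matrix_exp_def by (simp add: sums_iff mult.commute)
qed

lemma matrix_pow_nonneg:
  assumes "\<And>u v. u \<in> S \<Longrightarrow> v \<in> S \<Longrightarrow> M u v \<in> \<real>\<^sub>\<ge>\<^sub>0" "u \<in> S" "v \<in> S"
  shows "matrix_pow S M k u v \<in> \<real>\<^sub>\<ge>\<^sub>0"
  using assms(2)
proof (induction k arbitrary: u)
  case (Suc k)
  have "sum f T \<in> \<real>\<^sub>\<ge>\<^sub>0" if "\<And>w. w \<in> T \<Longrightarrow> f w \<in> \<real>\<^sub>\<ge>\<^sub>0" for f :: "'a \<Rightarrow> complex" and T
    using that by (induction T rule: infinite_finite_induct) (auto intro: nonneg_Reals_add_I)
  then show ?case using Suc assms(1) by (auto intro!: nonneg_Reals_mult_I)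
qed auto

lemma nonneg_Reals_Re_pos: "z \<in> \<real>\<^sub>\<ge>\<^sub>0 \<Longrightarrow> z \<noteq> 0 \<Longrightarrow> 0 < Re z"
  by (auto simp: complex_nonneg_Reals_iff complex_eq_iff)

text \<open>No cancellation is possible between products of nonnegative entries, so a path of nonzero entries makes
  the corresponding entry of a power nonzero.\<close>

lemma matrix_pow_path_nonzero:
  assumes S: "finite S" and nn: "\<And>u v. u \<in> S \<Longrightarrow> v \<in> S \<Longrightarrow> M u v \<in> \<real>\<^sub>\<ge>\<^sub>0"
    and path: "(u, v) \<in> {(a, b). a \<in> S \<and> b \<in> S \<and> M a b \<noteq> 0}\<^sup>*" and "v \<in> S"
  shows "\<exists>k. matrix_pow S M k u v \<noteq> 0"
  using path
proof (induction rule: converse_rtrancl_induct)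
  case base
  show ?case by (intro exI[of _ 0]) auto
next
  case (step a b)
  then obtain k where k: "matrix_pow S M k b v \<noteq> 0" by auto
  from step have ab: "a \<in> S" "b \<in> S" "M a b \<noteq> 0" by auto
  let ?f = "\<lambda>w. M a w * matrix_pow S M k w v"
  have nn': "?f w \<in> \<real>\<^sub>\<ge>\<^sub>0" if "w \<in> S" for w
    using that ab \<open>v \<in> S\<close> by (intro nonneg_Reals_mult_I nn matrix_pow_nonneg) auto
  have "0 < (\<Sum>w\<in>S. Re (?f w))"
  proof (rule sum_pos2[OF S ab(2)])
    show "0 < Re (?f b)" by (rule nonneg_Reals_Re_pos[OF nn'[OF ab(2)]]) (use k ab in simp)
    show "0 \<le> Re (?f i)" if "i \<in> S" for i using nn'[OF that] unfolding complex_nonneg_Reals_iff by blast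
  qed
  then have "0 < Re (matrix_pow S M (Suc k) a v)" by (simp only: matrix_pow.simps Re_sum)
  then have "matrix_pow S M (Suc k) a v \<noteq> 0" by (metis less_irrefl zero_complex.sel(1))
  then show ?case by blast
qed

lemma matrix_exp_pos:
  assumes S: "finite S" and nn: "\<And>u v. u \<in> S \<Longrightarrow> v \<in> S \<Longrightarrow> M u v \<in> \<real>\<^sub>\<ge>\<^sub>0"
    and path: "(u, v) \<in> {(a, b). a \<in> S \<and> b \<in> S \<and> M a b \<noteq> 0}\<^sup>*" and uv: "u \<in> S" "v \<in> S"
  shows "matrix_exp S M u v \<in> \<real> \<and> 0 < Re (matrix_exp S M u v)"
proof -
  let ?a = "\<lambda>k. matrix_pow S M k u v / fact k"
  have nn': "?a k \<in> \<real>\<^sub>\<ge>\<^sub>0" for k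
  proof (intro nonneg_Reals_divide_I matrix_pow_nonneg nn uv)
    show "(fact k :: complex) \<in> \<real>\<^sub>\<ge>\<^sub>0" using nonneg_Reals_of_real_iff[of "fact k", where 'a = complex] by simp
  qed
  have sm: "summable ?a" by (rule summable_norm_cancel[OF summable_norm_matrix_exp[OF S uv(1)]])
  obtain k where k: "matrix_pow S M k u v \<noteq> 0"
    using matrix_pow_path_nonzero[OF S nn path uv(2)] by auto
  have "0 < (\<Sum>k. Re (?a k))"
  proof (rule suminf_pos2)
    show "summable (\<lambda>k. Re (?a k))" using sm by (rule summable_Re)
    show "0 \<le> Re (?a n)" for n using nn'[of n] unfolding complex_nonneg_Reals_iff by blast
    have "?a k \<noteq> 0" using k by simp
    then show "0 < Re (?a k)" by (rule nonneg_Reals_Re_pos[OF nn'])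
  qed
  moreover have "(\<lambda>k. Im (?a k)) = (\<lambda>_. 0)" using nn' unfolding complex_nonneg_Reals_iff by blast
  ultimately show ?thesis
    unfolding matrix_exp_def Re_suminf[OF sm] complex_is_Real_iff Im_suminf[OF sm] by simp
qed

text \<open>Adding a large multiple of the identity makes the matrix nonnegative and only multiplies its exponential
  by a positive number.\<close>

lemma matrix_exp_pos_offdiagonal:
  fixes A :: "'v \<Rightarrow> 'v \<Rightarrow> real"
  assumes S: "finite S" and off: "\<And>u v. u \<in> S \<Longrightarrow> v \<in> S \<Longrightarrow> u \<noteq> v \<Longrightarrow> 0 \<le> A u v"
    and path: "(u, v) \<in> {(a, b). a \<in> S \<and> b \<in> S \<and> a \<noteq> b \<and> A a b \<noteq> 0}\<^sup>*" and uv: "u \<in> S" "v \<in> S"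
    and M: "\<And>u v. u \<in> S \<Longrightarrow> v \<in> S \<Longrightarrow> M u v = complex_of_real (A u v)"
  shows "matrix_exp S M u v \<in> \<real> \<and> 0 < Re (matrix_exp S M u v)"
proof -
  \<comment> \<open>Any number that makes all diagonal entries of \<open>A + c\<close> nonnegative will do.\<close>
  define c where "c = (\<Sum>u\<in>S. \<bar>A u u\<bar>)"
  have c: "0 \<le> A w w + c" if "w \<in> S" for w
    using member_le_sum[of w S "\<lambda>w. \<bar>A w w\<bar>"] that S by (auto simp: c_def)
  let ?B = "\<lambda>u v. M u v + (if u = v then complex_of_real c else 0)"
  have "(u, v) \<in> {(a, b). a \<in> S \<and> b \<in> S \<and> ?B a b \<noteq> 0}\<^sup>*"
    by (rule rtrancl_mono[THEN subsetD, OF _ path]) (auto simp: M)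
  moreover have "?B u v \<in> \<real>\<^sub>\<ge>\<^sub>0" if "u \<in> S" "v \<in> S" for u v
    using off[OF that] c[OF that(1)] by (auto simp: M that simp flip: of_real_add)
  ultimately have "matrix_exp S ?B u v \<in> \<real> \<and> 0 < Re (matrix_exp S ?B u v)"
    using matrix_exp_pos[OF S _ _ uv, of ?B] by blast
  moreover have "matrix_exp S M u v = complex_of_real (exp (- c)) * matrix_exp S ?B u v"
    unfolding matrix_exp_add_scalar[OF S uv(1)] by (simp add: exp_of_real exp_minus)
  ultimately show ?thesis by (auto simp: Re_complex_of_real)
qed


section \<open>Sobolev functions on an interval\<close>

lemma L2_intervalD:
  assumes "f \<in> L2_interval l"
  shows "f \<in> borel_measurable (lebesgue_on {0..l})" "integrable (lebesgue_on {0..l}) (\<lambda>x. (cmod (f x))\<^sup>2)"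
  using assms by (auto simp: L2_interval_def)

lemma L2_interval_integrable:
  assumes "f \<in> L2_interval l"
  shows "integrable (lebesgue_on {0..l}) f"
proof (rule Bochner_Integration.integrable_bound)
  show "integrable (lebesgue_on {0..l}) (\<lambda>x. 1 + (cmod (f x))\<^sup>2)"
    using L2_intervalD[OF assms] by auto
  show "AE x in lebesgue_on {0..l}. cmod (f x) \<le> norm (1 + (cmod (f x))\<^sup>2)"
  proof (rule AE_I2)
    fix x
    have "0 \<le> (cmod (f x) - 1 / 2)\<^sup>2" by simp
    then have "cmod (f x) \<le> 1 + (cmod (f x))\<^sup>2" by (simp add: power2_eq_square algebra_simps)
    then show "cmod (f x) \<le> norm (1 + (cmod (f x))\<^sup>2)" by simp
  qed
qed (rule L2_intervalD[OF assms])

lemma L2_interval_continuous: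
  assumes "continuous_on {0..l} f" shows "f \<in> L2_interval l"
  unfolding L2_interval_def
  by (auto intro!: continuous_imp_measurable_on_sets_lebesgue continuous_imp_integrable_real
      continuous_intros assms)

lemma L2_interval_add:
  assumes f: "f \<in> L2_interval l" and g: "g \<in> L2_interval l"
  shows "(\<lambda>x. f x + g x) \<in> L2_interval l"
proof -
  note [measurable] = L2_intervalD(1)[OF f] L2_intervalD(1)[OF g]
  have "integrable (lebesgue_on {0..l}) (\<lambda>x. (cmod (f x + g x))\<^sup>2)"
  proof (rule Bochner_Integration.integrable_bound)
    show "integrable (lebesgue_on {0..l}) (\<lambda>x. 2 * (cmod (f x))\<^sup>2 + 2 * (cmod (g x))\<^sup>2)"
      using L2_intervalD(2)[OF f] L2_intervalD(2)[OF g] by auto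
    show "AE x in lebesgue_on {0..l}. norm ((cmod (f x + g x))\<^sup>2) \<le> norm (2 * (cmod (f x))\<^sup>2 + 2 * (cmod (g x))\<^sup>2)"
    proof (rule AE_I2)
      fix x
      have "(cmod (f x + g x))\<^sup>2 \<le> (cmod (f x) + cmod (g x))\<^sup>2"
        by (intro power_mono norm_triangle_ineq) auto
      also have "\<dots> \<le> 2 * (cmod (f x))\<^sup>2 + 2 * (cmod (g x))\<^sup>2"
        using zero_le_power2[of "cmod (f x) - cmod (g x)"] by (simp add: power2_eq_square algebra_simps)
      finally show "norm ((cmod (f x + g x))\<^sup>2) \<le> norm (2 * (cmod (f x))\<^sup>2 + 2 * (cmod (g x))\<^sup>2)" by simp
    qed
  qed measurable
  then show ?thesis by (simp add: L2_interval_def)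
qed

lemma L2_interval_mult_continuous:
  assumes f: "f \<in> L2_interval l" and g: "continuous_on {0..l} (g :: real \<Rightarrow> complex)"
  shows "(\<lambda>x. g x * f x) \<in> L2_interval l"
proof -
  have gm[measurable]: "g \<in> borel_measurable (lebesgue_on {0..l})"
    by (intro continuous_imp_measurable_on_sets_lebesgue g) auto
  note [measurable] = L2_intervalD(1)[OF f]
  have "compact (g ` {0..l})" by (intro compact_continuous_image g) auto
  then obtain K where K: "\<And>x. x \<in> {0..l} \<Longrightarrow> cmod (g x) \<le> K"
    using compact_imp_bounded bounded_iff by (metis imageI)
  have "integrable (lebesgue_on {0..l}) (\<lambda>x. (cmod (g x * f x))\<^sup>2)"
  proof (rule Bochner_Integration.integrable_bound)
    show "integrable (lebesgue_on {0..l}) (\<lambda>x. K\<^sup>2 * (cmod (f x))\<^sup>2)"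
      using L2_intervalD(2)[OF f] by auto
    show "AE x in lebesgue_on {0..l}. norm ((cmod (g x * f x))\<^sup>2) \<le> norm (K\<^sup>2 * (cmod (f x))\<^sup>2)"
      using K by (intro AE_I2) (auto simp: norm_mult power_mult_distrib intro!: mult_right_mono power_mono)
  qed measurable
  then show ?thesis by (simp add: L2_interval_def)
qed

text \<open>The Cauchy-Schwarz inequality, from the fact that the variance of \<open>cmod f\<close> is not negative.\<close>

lemma L2_interval_norm_bound:
  assumes f: "f \<in> L2_interval l" and l: "0 < l"
  shows "(LINT x|lebesgue_on {0..l}. cmod (f x)) \<le> sqrt l * sqrt (LINT x|lebesgue_on {0..l}. (cmod (f x))\<^sup>2)"
proof -
  let ?M = "lebesgue_on {0..l}"
  define A where "A = (LINT x|?M. cmod (f x))"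
  define B where "B = (LINT x|?M. (cmod (f x))\<^sup>2)"
  note i1 = integrable_norm[OF L2_interval_integrable[OF f]] and i2 = L2_intervalD(2)[OF f]
  \<comment> \<open>The mean of \<open>cmod f\<close>.\<close>
  define m where "m = A / l"
  have "0 \<le> (LINT x|?M. (cmod (f x) - m)\<^sup>2)" by (rule Bochner_Integration.integral_nonneg) auto
  also have "(\<lambda>x. (cmod (f x) - m)\<^sup>2) = (\<lambda>x. ((cmod (f x))\<^sup>2 - 2 * m * cmod (f x)) + m\<^sup>2)"
    by (auto simp: power2_eq_square algebra_simps)
  also have "(LINT x|?M. ((cmod (f x))\<^sup>2 - 2 * m * cmod (f x)) + m\<^sup>2) = B - 2 * m * A + m\<^sup>2 * l"
    using i1 i2 l by (simp add: A_def B_def measure_restrict_space)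
  finally have "A\<^sup>2 \<le> l * B" using l by (simp add: m_def power2_eq_square field_simps)
  then have "A \<le> sqrt (l * B)" by (rule real_le_rsqrt)
  then show ?thesis by (simp add: A_def B_def real_sqrt_mult)
qed

lemma L2_interval_integrable_sub:
  assumes "g \<in> L2_interval l" "x \<in> {0..l}"
  shows "integrable (lebesgue_on {0..x}) g"
  using integrable_subinterval[OF L2_interval_integrable[OF assms(1)]] assms(2) by simp

lemma H1_derivD:
  assumes "H1_deriv l f g"
  shows "g \<in> L2_interval l" "\<And>x. x \<in> {0..l} \<Longrightarrow> f x = f 0 + (LINT t|lebesgue_on {0..x}. g t)"
  using assms unfolding H1_deriv_def by blast+

lemma H1_deriv_continuous:
  assumes "H1_deriv l f g"
  shows "continuous_on {0..l} f"
proof -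
  have "continuous_on {0..l} (\<lambda>x. f 0 + (LINT t|lebesgue_on {0..x}. g t))"
    by (rule continuous_on_add[OF continuous_on_const
          indefinite_integral_continuous_real[OF L2_interval_integrable[OF H1_derivD(1)[OF assms]]]])
  then show ?thesis by (rule continuous_on_eq) (rule H1_derivD(2)[OF assms, symmetric])
qed

lemma H1_deriv_has_vector_derivative:
  assumes f: "H1_deriv l f g" and g: "continuous_on {0..l} g" and x: "x \<in> {0..l}"
  shows "(f has_vector_derivative g x) (at x within {0..l})"
proof -
  have "((\<lambda>x. f 0 + integral {0..x} g) has_vector_derivative g x) (at x within {0..l})"
    using has_vector_derivative_add[OF has_vector_derivative_const integral_has_vector_derivative[OF g x]]
    by simp
  then show ?thesis
  proof (rule has_vector_derivative_transform[OF x, rotated])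
    fix y assume y: "y \<in> {0..l}"
    show "f y = f 0 + integral {0..y} g"
      using H1_derivD(2)[OF f y] lebesgue_integral_eq_integral[OF L2_interval_integrable_sub[OF H1_derivD(1)[OF f] y]]
      by simp
  qed
qed

lemma H1_deriv_cong:
  assumes "H1_deriv l f g" "\<And>x. x \<in> {0..l} \<Longrightarrow> f x = f' x" "\<And>x. x \<in> {0..l} \<Longrightarrow> g x = g' x"
  shows "H1_deriv l f' g'"
proof -
  show ?thesis
    unfolding H1_deriv_def
  proof (intro conjI ballI)
    have "g' \<in> borel_measurable (lebesgue_on {0..l}) \<longleftrightarrow> g \<in> borel_measurable (lebesgue_on {0..l})"
      by (intro measurable_cong) (simp add: assms(3))
    moreover have "integrable (lebesgue_on {0..l}) (\<lambda>x. (cmod (g' x))\<^sup>2) \<longleftrightarrow>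
        integrable (lebesgue_on {0..l}) (\<lambda>x. (cmod (g x))\<^sup>2)"
      by (intro Bochner_Integration.integrable_cong) (simp_all add: assms(3))
    ultimately show "g' \<in> L2_interval l" using H1_derivD(1)[OF assms(1)] by (simp add: L2_interval_def)
    fix x assume x: "x \<in> {0..l}"
    have "(LINT t|lebesgue_on {0..x}. g t) = (LINT t|lebesgue_on {0..x}. g' t)"
      using x by (intro Bochner_Integration.integral_cong) (simp_all add: assms(3))
    moreover have "f 0 = f' 0" using x by (intro assms(2)) simp
    ultimately show "f' x = f' 0 + (LINT t|lebesgue_on {0..x}. g' t)"
      using H1_derivD(2)[OF assms(1) x] assms(2)[OF x] by simp
  qed
qed

lemma H1_deriv_const: "H1_deriv l (\<lambda>_. a) (\<lambda>_. 0)"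
  by (auto simp: H1_deriv_def intro!: L2_interval_continuous)

lemma H1_deriv_integral:
  assumes "g \<in> L2_interval l"
  shows "H1_deriv l (\<lambda>x. LINT t|lebesgue_on {0..x}. g t) g"
proof -
  have "(LINT t|lebesgue_on {0..0}. g t) = 0"
    using L2_interval_integrable_sub[OF assms, of 0]
    by (cases "l < 0") (auto intro: integral_eq_zero_null_sets simp: null_sets_restrict_space)
  with assms show ?thesis by (auto simp: H1_deriv_def)
qed

lemma H1_deriv_add:
  assumes f: "H1_deriv l f f'" and g: "H1_deriv l g g'"
  shows "H1_deriv l (\<lambda>x. f x + g x) (\<lambda>x. f' x + g' x)"
  unfolding H1_deriv_def
proof (intro conjI ballI)
  show "(\<lambda>x. f' x + g' x) \<in> L2_interval l" by (rule L2_interval_add[OF H1_derivD(1)[OF f] H1_derivD(1)[OF g]])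
  fix x assume x: "x \<in> {0..l}"
  have "(LINT t|lebesgue_on {0..x}. f' t + g' t) = (LINT t|lebesgue_on {0..x}. f' t) + (LINT t|lebesgue_on {0..x}. g' t)"
    by (rule Bochner_Integration.integral_add[OF L2_interval_integrable_sub[OF H1_derivD(1)[OF f] x]
          L2_interval_integrable_sub[OF H1_derivD(1)[OF g] x]])
  then show "f x + g x = f 0 + g 0 + (LINT t|lebesgue_on {0..x}. f' t + g' t)"
    using H1_derivD(2)[OF f x] H1_derivD(2)[OF g x] by simp
qed

text \<open>Fubini's theorem on the triangle \<open>t \<le> s \<le> x\<close>.\<close>

lemma integral_triangle_swap:
  fixes g :: "real \<Rightarrow> complex" and \<psi> :: "real \<Rightarrow> real"
  assumes g: "integrable (lebesgue_on {0..x}) g" and \<psi>: "continuous_on {0..x} \<psi>"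
  shows "(LINT s|lebesgue_on {0..x}. \<psi> s *\<^sub>R (LINT t|lebesgue_on {0..s}. g t)) =
         (LINT t|lebesgue_on {0..x}. (LINT s|lebesgue_on {t..x}. \<psi> s) *\<^sub>R g t)"
proof -
  let ?M = "lebesgue_on {0..x}"
  interpret M: finite_measure ?M by (intro finite_measure_lebesgue_on) auto
  interpret P: pair_sigma_finite ?M ?M by unfold_locales
  have \<psi>i: "integrable ?M \<psi>" by (rule continuous_imp_integrable_real[OF \<psi>])
  note [measurable] = borel_measurable_integrable[OF g] borel_measurable_integrable[OF \<psi>i]
  have prod: "integrable (?M \<Otimes>\<^sub>M ?M) (\<lambda>(s, t). \<psi> s *\<^sub>R g t)"
  proof (rule P.Fubini_integrable)
    show "(\<lambda>(s, t). \<psi> s *\<^sub>R g t) \<in> borel_measurable (?M \<Otimes>\<^sub>M ?M)" by measurable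
    show "integrable ?M (\<lambda>s. LINT t|?M. norm (case (s, t) of (s, t) \<Rightarrow> \<psi> s *\<^sub>R g t))"
      using integrable_norm[OF \<psi>i] by simp
    show "AE s in ?M. integrable ?M (\<lambda>t. case (s, t) of (s, t) \<Rightarrow> \<psi> s *\<^sub>R g t)"
      using g by (intro AE_I2) simp
  qed
  have id: "(\<lambda>t. t) \<in> borel_measurable ?M" using id_borel_measurable_lebesgue_on[of "{0..x}"] by (simp add: id_def)
  have A: "{p \<in> space (?M \<Otimes>\<^sub>M ?M). snd p \<le> fst p} \<in> sets (?M \<Otimes>\<^sub>M ?M)"
    by (rule borel_measurable_le) (rule measurable_compose[OF measurable_snd id], rule measurable_compose[OF measurable_fst id])
  have "integrable (?M \<Otimes>\<^sub>M ?M) (\<lambda>p. indicator {p \<in> space (?M \<Otimes>\<^sub>M ?M). snd p \<le> fst p} p *\<^sub>R (case p of (s, t) \<Rightarrow> \<psi> s *\<^sub>R g t))"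
    by (rule integrable_mult_indicator[OF A prod])
  then have int: "integrable (?M \<Otimes>\<^sub>M ?M) (\<lambda>(s, t). if t \<le> s then \<psi> s *\<^sub>R g t else 0)"
    by (rule Bochner_Integration.integrable_cong[THEN iffD1, rotated -1])
       (auto simp: space_pair_measure indicator_def)
  have "(LINT s|?M. \<psi> s *\<^sub>R (LINT t|lebesgue_on {0..s}. g t)) =
      (LINT s|?M. LINT t|?M. (if t \<le> s then \<psi> s *\<^sub>R g t else 0))"
  proof (rule Bochner_Integration.integral_cong[OF refl])
    fix s assume "s \<in> space ?M"
    then have s: "s \<in> {0..x}" by simp
    have "\<psi> s *\<^sub>R (LINT t|lebesgue_on {0..s}. g t) = \<psi> s *\<^sub>R (LINT t|?M. (if t \<in> {0..s} then g t else 0))"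
      using s by (subst integral_restrict) auto
    also have "\<dots> = (LINT t|?M. \<psi> s *\<^sub>R (if t \<in> {0..s} then g t else 0))" by simp
    also have "\<dots> = (LINT t|?M. (if t \<le> s then \<psi> s *\<^sub>R g t else 0))"
      by (rule Bochner_Integration.integral_cong) auto
    finally show "\<psi> s *\<^sub>R (LINT t|lebesgue_on {0..s}. g t) = \<dots>" .
  qed
  also have "\<dots> = (LINT t|?M. LINT s|?M. (if t \<le> s then \<psi> s *\<^sub>R g t else 0))"
    by (rule P.Fubini_integral[OF int, symmetric])
  also have "\<dots> = (LINT t|?M. (LINT s|lebesgue_on {t..x}. \<psi> s) *\<^sub>R g t)"
  proof (rule Bochner_Integration.integral_cong[OF refl])
    fix t assume "t \<in> space ?M"
    then have t: "t \<in> {0..x}" by simp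
    have "(LINT s|lebesgue_on {t..x}. \<psi> s) *\<^sub>R g t = (LINT s|?M. (if s \<in> {t..x} then \<psi> s else 0)) *\<^sub>R g t"
      using t by (subst integral_restrict) auto
    also have "\<dots> = (LINT s|?M. (if s \<in> {t..x} then \<psi> s else 0) *\<^sub>R g t)"
    proof (rule integral_scaleR_left[symmetric])
      assume "g t \<noteq> 0"
      have "integrable ?M (\<lambda>s. indicator {t..x} s *\<^sub>R \<psi> s)"
        by (rule integrable_mult_indicator[OF _ \<psi>i]) (use t in \<open>auto simp: sets_restrict_space_iff\<close>)
      then show "integrable ?M (\<lambda>s. if s \<in> {t..x} then \<psi> s else 0)"
        by (rule Bochner_Integration.integrable_cong[THEN iffD1, rotated -1]) (auto simp: indicator_def)
    qed
    also have "\<dots> = (LINT s|?M. (if t \<le> s then \<psi> s *\<^sub>R g t else 0))"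
      by (rule Bochner_Integration.integral_cong) auto
    finally show "(LINT s|?M. (if t \<le> s then \<psi> s *\<^sub>R g t else 0)) = (LINT s|lebesgue_on {t..x}. \<psi> s) *\<^sub>R g t" ..
  qed
  finally show ?thesis .
qed

lemma integral_real_FTC:
  fixes \<phi> :: "real \<Rightarrow> real"
  assumes d: "\<And>x. (\<phi> has_real_derivative \<phi>' x) (at x)" and c: "continuous_on UNIV \<phi>'" and "a \<le> b"
  shows "(LINT t|lebesgue_on {a..b}. \<phi>' t) = \<phi> b - \<phi> a"
proof -
  have c': "continuous_on {a..b} \<phi>'" using c continuous_on_subset by blast
  have "(\<phi>' has_integral (\<phi> b - \<phi> a)) {a..b}"
    by (intro fundamental_theorem_of_calculus \<open>a \<le> b\<close>)
      (use d in \<open>auto simp: has_real_derivative_iff_has_vector_derivative[symmetric] intro: has_field_derivative_at_within\<close>)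
  then have "integral {a..b} \<phi>' = \<phi> b - \<phi> a" by (rule integral_unique)
  then show ?thesis
    using lebesgue_integral_eq_integral[OF continuous_imp_integrable_real[OF c']] by simp
qed

text \<open>The product rule with a \<open>C\<^sup>1\<close> factor, that is, integration by parts for an absolutely continuous function.
  Since \<open>F\<close> is given as an indefinite integral, the term \<open>\<integral> \<phi>' F\<close> is an integral over a triangle, and exchanging
  the order of integration moves the integration onto \<open>\<phi>'\<close>.\<close>

lemma H1_deriv_mult:
  fixes \<phi> :: "real \<Rightarrow> real"
  assumes F: "H1_deriv l F g"
    and d: "\<And>x. (\<phi> has_real_derivative \<phi>' x) (at x)" and c: "continuous_on UNIV \<phi>'"
  shows "H1_deriv l (\<lambda>x. \<phi> x *\<^sub>R F x) (\<lambda>x. \<phi> x *\<^sub>R g x + \<phi>' x *\<^sub>R F x)"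
  unfolding H1_deriv_def
proof (intro conjI ballI)
  have c\<phi>: "continuous_on A \<phi>" for A
    by (rule DERIV_continuous_on) (use d in \<open>auto intro: has_field_derivative_at_within\<close>)
  have c\<phi>': "continuous_on A \<phi>'" for A using c continuous_on_subset by blast
  note gL = H1_derivD(1)[OF F]
  have L1: "(\<lambda>x. \<phi> x *\<^sub>R g x) \<in> L2_interval l"
    unfolding scaleR_conv_of_real by (intro L2_interval_mult_continuous gL continuous_intros c\<phi>)
  have L2: "(\<lambda>x. \<phi>' x *\<^sub>R F x) \<in> L2_interval l"
    by (intro L2_interval_continuous continuous_intros c\<phi>' H1_deriv_continuous[OF F])
  show "(\<lambda>x. \<phi> x *\<^sub>R g x + \<phi>' x *\<^sub>R F x) \<in> L2_interval l" by (rule L2_interval_add[OF L1 L2])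
  fix x assume x: "x \<in> {0..l}"
  let ?M = "lebesgue_on {0..x}"
  note gi = L2_interval_integrable_sub[OF gL x]
  note i1 = L2_interval_integrable_sub[OF L1 x] and i2 = L2_interval_integrable_sub[OF L2 x]
  let ?G = "\<lambda>s. LINT t|lebesgue_on {0..s}. g t"
  have cG: "continuous_on {0..x} ?G" by (rule indefinite_integral_continuous_real[OF gi])
  have "(LINT s|?M. \<phi>' s *\<^sub>R F s) = (LINT s|?M. \<phi>' s *\<^sub>R F 0 + \<phi>' s *\<^sub>R ?G s)"
  proof (rule Bochner_Integration.integral_cong[OF refl])
    fix s assume "s \<in> space ?M"
    with x have "s \<in> {0..l}" by auto
    then show "\<phi>' s *\<^sub>R F s = \<phi>' s *\<^sub>R F 0 + \<phi>' s *\<^sub>R ?G s"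
      using H1_derivD(2)[OF F, of s] by (simp add: scaleR_add_right)
  qed
  also have "\<dots> = (LINT s|?M. \<phi>' s *\<^sub>R F 0) + (LINT s|?M. \<phi>' s *\<^sub>R ?G s)"
    by (intro Bochner_Integration.integral_add continuous_imp_integrable_real continuous_intros c\<phi>' cG)
  also have "(LINT s|?M. \<phi>' s *\<^sub>R F 0) = (\<phi> x - \<phi> 0) *\<^sub>R F 0"
    using x integral_real_FTC[OF d c, of 0 x] continuous_imp_integrable_real[OF c\<phi>', of 0 x]
    by (subst integral_scaleR_left) auto
  also have "(LINT s|?M. \<phi>' s *\<^sub>R ?G s) = (LINT t|?M. (\<phi> x - \<phi> t) *\<^sub>R g t)"
    unfolding integral_triangle_swap[OF gi c\<phi>']
    by (intro Bochner_Integration.integral_cong[OF refl]) (simp add: integral_real_FTC[OF d c])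
  also have "\<dots> = (LINT t|?M. \<phi> x *\<^sub>R g t - \<phi> t *\<^sub>R g t)" by (simp add: scaleR_diff_left)
  also have "\<dots> = \<phi> x *\<^sub>R ?G x - (LINT t|?M. \<phi> t *\<^sub>R g t)"
    using gi i1 by (subst Bochner_Integration.integral_diff) auto
  finally have "(LINT s|?M. \<phi> s *\<^sub>R g s + \<phi>' s *\<^sub>R F s) = (\<phi> x - \<phi> 0) *\<^sub>R F 0 + \<phi> x *\<^sub>R ?G x"
    using Bochner_Integration.integral_add[OF i1 i2] by simp
  then show "\<phi> x *\<^sub>R F x = \<phi> 0 *\<^sub>R F 0 + (LINT s|?M. \<phi> s *\<^sub>R g s + \<phi>' s *\<^sub>R F s)"
    using H1_derivD(2)[OF F x] by (simp add: algebra_simps)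
qed

lemma AE_zero_continuous:
  fixes f :: "real \<Rightarrow> complex"
  assumes f: "continuous_on {0..l} f" and l: "0 < l" and ae: "AE x in lebesgue_on {0..l}. f x = 0"
    and x: "x \<in> {0..l}"
  shows "f x = 0"
proof -
  have "(LINT x|lebesgue_on {0..l}. cmod (f x)) = (LINT x|lebesgue_on {0..l}. 0)"
    using ae by (intro integral_cong_AE continuous_imp_measurable_on_sets_lebesgue continuous_intros f) auto
  then have "(LINT x|lebesgue_on {0..l}. cmod (f x)) = 0" by simp
  then have "\<forall>x\<in>{0..l}. cmod (f x) = 0"
    by (subst (asm) integralL_eq_0_iff) (auto intro!: continuous_intros f l)
  with x show ?thesis by auto
qed


section \<open>The inhomogeneous equation on an edge\<close>

text \<open>The derivative of \<open>\<phi> h - \<phi>' f\<close> is \<open>\<phi> (g + lam f)\<close>, where \<open>h = f'\<close> and \<open>g = f''\<close>, because \<open>\<phi>\<close> solves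
  \<open>\<phi>'' = - lam \<phi>\<close>.\<close>

lemma lagrange_identity:
  fixes \<phi> :: "real \<Rightarrow> real"
  assumes f: "H1_deriv l f h" and h: "H1_deriv l h g"
    and d1: "\<And>t. (\<phi> has_real_derivative \<psi> t) (at t)"
    and d2: "\<And>t. (\<psi> has_real_derivative - lam * \<phi> t) (at t)"
    and x: "x \<in> {0..l}"
  shows "\<phi> x *\<^sub>R h x - \<psi> x *\<^sub>R f x = \<phi> 0 *\<^sub>R h 0 - \<psi> 0 *\<^sub>R f 0 +
    (LINT t|lebesgue_on {0..x}. \<phi> t *\<^sub>R (g t + complex_of_real lam * f t))"
proof -
  have c1: "continuous_on UNIV \<phi>" by (rule DERIV_continuous_on[OF d1])
  have c2: "continuous_on UNIV \<psi>" by (rule DERIV_continuous_on[OF d2])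
  have d3: "((\<lambda>t. - \<psi> t) has_real_derivative lam * \<phi> t) (at t)" for t
    using DERIV_minus[OF d2[of t]] by simp
  have c3: "continuous_on UNIV (\<lambda>t. lam * \<phi> t)" by (rule continuous_on_mult_left[OF c1])
  from H1_deriv_add[OF H1_deriv_mult[OF h d1 c2] H1_deriv_mult[OF f d3 c3]]
  have "H1_deriv l (\<lambda>t. \<phi> t *\<^sub>R h t - \<psi> t *\<^sub>R f t) (\<lambda>t. \<phi> t *\<^sub>R (g t + complex_of_real lam * f t))"
    by (rule H1_deriv_cong) (simp_all add: scaleR_conv_of_real algebra_simps)
  from H1_derivD(2)[OF this x] show ?thesis .
qed

definition sin_conv :: "real \<Rightarrow> real \<Rightarrow> (real \<Rightarrow> complex) \<Rightarrow> complex" where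
  "sin_conv lam x r = (LINT t|lebesgue_on {0..x}. sin_sol lam (x - t) *\<^sub>R r t)"

definition cos_conv :: "real \<Rightarrow> real \<Rightarrow> (real \<Rightarrow> complex) \<Rightarrow> complex" where
  "cos_conv lam x r = (LINT t|lebesgue_on {0..x}. cos_sol lam (x - t) *\<^sub>R r t)"

text \<open>Lagrange's identity with \<open>\<phi> t = sin_sol lam (x - t)\<close> isolates \<open>f x\<close>, and with \<open>\<phi> t = cos_sol lam (x - t)\<close> it
  isolates \<open>h x = f' x\<close>. In particular this is uniqueness for the Cauchy problem with \<open>L\<^sup>2\<close> right-hand side.\<close>

lemma duhamel:
  assumes f: "H1_deriv l f h" and h: "H1_deriv l h g" and x: "x \<in> {0..l}"
  shows "f x = cos_sol lam x *\<^sub>R f 0 + sin_sol lam x *\<^sub>R h 0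
        + sin_conv lam x (\<lambda>t. g t + complex_of_real lam * f t)"
    and "h x = cos_sol lam x *\<^sub>R h 0 - (lam * sin_sol lam x) *\<^sub>R f 0
        + cos_conv lam x (\<lambda>t. g t + complex_of_real lam * f t)"
proof -
  have d1: "((\<lambda>t. sin_sol lam (x - t)) has_real_derivative - cos_sol lam (x - t)) (at t)" for t
    by (auto intro!: derivative_eq_intros)
  have d2: "((\<lambda>t. - cos_sol lam (x - t)) has_real_derivative - lam * sin_sol lam (x - t)) (at t)" for t
    by (auto intro!: derivative_eq_intros)
  from lagrange_identity[OF f h d1 d2 x]
  show "f x = cos_sol lam x *\<^sub>R f 0 + sin_sol lam x *\<^sub>R h 0
        + sin_conv lam x (\<lambda>t. g t + complex_of_real lam * f t)"
    by (simp add: sin_conv_def add.commute)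
  have e1: "((\<lambda>t. cos_sol lam (x - t)) has_real_derivative lam * sin_sol lam (x - t)) (at t)" for t
    by (auto intro!: derivative_eq_intros)
  have e2: "((\<lambda>t. lam * sin_sol lam (x - t)) has_real_derivative - lam * cos_sol lam (x - t)) (at t)" for t
    by (auto intro!: derivative_eq_intros)
  from lagrange_identity[OF f h e1 e2 x]
  show "h x = cos_sol lam x *\<^sub>R h 0 - (lam * sin_sol lam x) *\<^sub>R f 0
        + cos_conv lam x (\<lambda>t. g t + complex_of_real lam * f t)"
    by (simp add: cos_conv_def)
qed

text \<open>The outward derivatives at the two ends in terms of the boundary values and the source
  \<open>r = f'' + lam f\<close>: Duhamel's formula at \<open>x = l\<close>, solved for \<open>f' 0\<close>, and then the Wronskian identity for
  \<open>f' l\<close>. Both ends have the same form, up to the contribution of the source.\<close>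

lemma boundary_derivatives:
  assumes f: "H1_deriv l f h" and h: "H1_deriv l h g" and l: "0 \<le> l" and S: "sin_sol lam l \<noteq> 0"
    and r: "\<And>t. r t = g t + complex_of_real lam * f t"
  shows "- h 0 = (1 / sin_sol lam l) *\<^sub>R (cos_sol lam l *\<^sub>R f 0 - f l) + (1 / sin_sol lam l) *\<^sub>R sin_conv lam l r"
    and "h l = (1 / sin_sol lam l) *\<^sub>R (cos_sol lam l *\<^sub>R f l - f 0)
      + (cos_conv lam l r - (cos_sol lam l / sin_sol lam l) *\<^sub>R sin_conv lam l r)"
proof -
  have r': "(\<lambda>t. g t + complex_of_real lam * f t) = r" using r by auto
  let ?C = "complex_of_real (cos_sol lam l)" and ?S = "complex_of_real (sin_sol lam l)"
  let ?P = "sin_conv lam l r" and ?Q = "cos_conv lam l r"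
  have S': "?S \<noteq> 0" using S by simp
  have l': "l \<in> {0..l}" using l by simp
  have 1: "f l = ?C * f 0 + ?S * h 0 + ?P"
    using duhamel(1)[OF f h l', of lam] unfolding r' by (simp add: scaleR_conv_of_real)
  have 2: "h l = ?C * h 0 - of_real lam * ?S * f 0 + ?Q"
    using duhamel(2)[OF f h l', of lam] unfolding r' by (simp add: scaleR_conv_of_real)
  have 3: "?C * ?C + of_real lam * ?S * ?S = 1"
    using arg_cong[OF cos_sol_sin_sol_squares[of lam l], of complex_of_real] by (simp add: power2_eq_square mult.assoc)
  have 4: "h 0 = (f l - ?C * f 0 - ?P) / ?S" using 1 S' by (simp add: field_simps)
  then show "- h 0 = (1 / sin_sol lam l) *\<^sub>R (cos_sol lam l *\<^sub>R f 0 - f l) + (1 / sin_sol lam l) *\<^sub>R ?P"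
    using S' by (simp add: scaleR_conv_of_real field_simps)
  \<comment> \<open>Multiplied by \<open>?S\<close>, the equation for \<open>h l\<close> can use \<open>?S * h 0\<close> without division.\<close>
  have "?S * h l = ?C * (?S * h 0) - (of_real lam * ?S * ?S) * f 0 + ?S * ?Q"
    unfolding 2 by (simp add: algebra_simps)
  also have "of_real lam * ?S * ?S = 1 - ?C * ?C" using 3 by (simp add: algebra_simps)
  also have "?S * h 0 = f l - ?C * f 0 - ?P" using 4 S' by simp
  finally have "?S * h l = ?C * f l - f 0 + ?S * ?Q - ?C * ?P" by (simp add: algebra_simps)
  then have "h l = (?C * f l - f 0 + ?S * ?Q - ?C * ?P) / ?S" using S' by (simp add: eq_divide_eq mult.commute)
  then show "h l = (1 / sin_sol lam l) *\<^sub>R (cos_sol lam l *\<^sub>R f l - f 0)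
      + (?Q - (cos_sol lam l / sin_sol lam l) *\<^sub>R ?P)"
    using S' by (simp add: scaleR_conv_of_real add_divide_distrib diff_divide_distrib)
qed

text \<open>With the coefficients \<open>A\<close>, \<open>B\<close> below, \<open>f = sin_sol A - cos_sol B\<close> has the derivative
  \<open>h = cos_sol A + lam sin_sol B\<close>, since the terms with \<open>A'\<close> and \<open>B'\<close> cancel; in \<open>h'\<close> they add up to \<open>r\<close> by the
  Wronskian identity.\<close>

lemma variation_of_constants:
  assumes r: "r \<in> L2_interval l"
  obtains f h where "H1_deriv l f h" "H1_deriv l h (\<lambda>x. r x - complex_of_real lam * f x)" "f 0 = a" "h 0 = b"
proof -
  let ?C = "cos_sol lam" and ?S = "sin_sol lam"
  have dC: "(?C has_real_derivative - lam * ?S t) (at t)" for t by (auto intro!: derivative_eq_intros)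
  have dS: "(?S has_real_derivative ?C t) (at t)" for t by (auto intro!: derivative_eq_intros)
  have dlS: "((\<lambda>t. lam * ?S t) has_real_derivative lam * ?C t) (at t)" for t by (auto intro!: derivative_eq_intros)
  have dmC: "((\<lambda>t. - ?C t) has_real_derivative lam * ?S t) (at t)" for t by (auto intro!: derivative_eq_intros)
  have cC: "continuous_on A ?C" and cS: "continuous_on A ?S" for A by (intro continuous_intros)+
  \<comment> \<open>The constants \<open>b\<close> and \<open>- a\<close> produce the initial values \<open>h 0 = b\<close> and \<open>f 0 = a\<close>.\<close>
  define A where "A x = b + (LINT t|lebesgue_on {0..x}. ?C t *\<^sub>R r t)" for x
  define B where "B x = - a + (LINT t|lebesgue_on {0..x}. ?S t *\<^sub>R r t)" for x
  have AL: "(\<lambda>t. ?C t *\<^sub>R r t) \<in> L2_interval l" and BL: "(\<lambda>t. ?S t *\<^sub>R r t) \<in> L2_interval l"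
    unfolding scaleR_conv_of_real
    by (intro L2_interval_mult_continuous r continuous_on_of_real cC cS)+
  have A: "H1_deriv l A (\<lambda>t. ?C t *\<^sub>R r t)"
    using H1_deriv_add[OF H1_deriv_const[of l "b"] H1_deriv_integral[OF AL]]
    by (rule H1_deriv_cong) (simp_all add: A_def)
  have B: "H1_deriv l B (\<lambda>t. ?S t *\<^sub>R r t)"
    using H1_deriv_add[OF H1_deriv_const[of l "- a"] H1_deriv_integral[OF BL]]
    by (rule H1_deriv_cong) (simp_all add: B_def)
  define f where "f x = ?S x *\<^sub>R A x + (- ?C x) *\<^sub>R B x" for x
  define h where "h x = ?C x *\<^sub>R A x + (lam * ?S x) *\<^sub>R B x" for x
  have sq: "complex_of_real (?C x) * of_real (?C x) + of_real lam * (of_real (?S x) * of_real (?S x)) = 1" for x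
    using arg_cong[OF cos_sol_sin_sol_squares[of lam x], of complex_of_real] by (simp add: power2_eq_square mult.assoc)
  have "H1_deriv l f h"
    using H1_deriv_add[OF H1_deriv_mult[OF A dS cC] H1_deriv_mult[OF B dmC continuous_on_mult_left[OF cS]]]
    unfolding f_def h_def
    by (rule H1_deriv_cong) (simp_all add: scaleR_conv_of_real algebra_simps)
  moreover have "H1_deriv l h (\<lambda>x. r x - complex_of_real lam * f x)"
    using H1_deriv_add[OF H1_deriv_mult[OF A dC continuous_on_mult_left[OF cS]]
        H1_deriv_mult[OF B dlS continuous_on_mult_left[OF cC]]]
    unfolding h_def
  proof (rule H1_deriv_cong)
    fix x
    have "?C x *\<^sub>R ?C x *\<^sub>R r x + (- lam * ?S x) *\<^sub>R A x + ((lam * ?S x) *\<^sub>R ?S x *\<^sub>R r x + (lam * ?C x) *\<^sub>R B x)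
        = (complex_of_real (?C x) * of_real (?C x) + of_real lam * (of_real (?S x) * of_real (?S x))) * r x
          - of_real lam * f x"
      by (simp add: f_def scaleR_conv_of_real algebra_simps)
    then show "?C x *\<^sub>R ?C x *\<^sub>R r x + (- lam * ?S x) *\<^sub>R A x + ((lam * ?S x) *\<^sub>R ?S x *\<^sub>R r x + (lam * ?C x) *\<^sub>R B x)
        = r x - complex_of_real lam * f x" unfolding sq by simp
  qed simp
  moreover have "A 0 = b" "B 0 = - a" if "(LINT t|lebesgue_on {0..0}. ?C t *\<^sub>R r t) = 0"
    "(LINT t|lebesgue_on {0..0}. ?S t *\<^sub>R r t) = 0"
    using that by (auto simp: A_def B_def)
  moreover have "(LINT t|lebesgue_on {0..0}. u t) = 0" for u :: "real \<Rightarrow> complex"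
    by (rule integral_eq_zero_null_sets) (simp add: null_sets_restrict_space)
  ultimately show ?thesis by (intro that[of f h]) (auto simp: f_def h_def)
qed

lemma convolution_bound:
  assumes \<phi>: "continuous_on UNIV (\<phi> :: real \<Rightarrow> real)" and l: "0 < l"
  shows "\<exists>K\<ge>0. \<forall>r\<in>L2_interval l. \<forall>x\<in>{0..l}.
    cmod (LINT t|lebesgue_on {0..x}. \<phi> (x - t) *\<^sub>R r t) \<le> K * sqrt (LINT t|lebesgue_on {0..l}. (cmod (r t))\<^sup>2)"
proof -
  have "compact (\<phi> ` {0..l})" by (intro compact_continuous_image continuous_on_subset[OF \<phi>]) auto
  then obtain K where K: "\<And>x. x \<in> {0..l} \<Longrightarrow> \<bar>\<phi> x\<bar> \<le> K"
    using compact_imp_bounded bounded_iff by (metis imageI real_norm_def)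
  from K[of 0] l have K0: "0 \<le> K" by auto
  show ?thesis
  proof (intro exI[of _ "K * sqrt l"] conjI ballI)
    show "0 \<le> K * sqrt l" using K0 l by simp
    fix r x assume r: "r \<in> L2_interval l" and x: "x \<in> {0..l}"
    have i: "integrable (lebesgue_on {0..x}) (\<lambda>t. cmod (r t))"
      by (intro integrable_norm L2_interval_integrable_sub[OF r x])
    have c: "continuous_on {0..x} (\<lambda>t. \<phi> (x - t))"
      by (rule continuous_on_compose2[OF \<phi>]) (auto intro!: continuous_intros)
    have m: "(\<lambda>t. \<phi> (x - t) *\<^sub>R r t) \<in> borel_measurable (lebesgue_on {0..x})"
      using borel_measurable_integrable[OF L2_interval_integrable_sub[OF r x]]
        continuous_imp_measurable_on_sets_lebesgue[OF c] by auto
    have le: "cmod (\<phi> (x - t) *\<^sub>R r t) \<le> K * cmod (r t)" if "t \<in> {0..x}" for t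
      using that x K[of "x - t"] by (auto intro!: mult_right_mono)
    have i2: "integrable (lebesgue_on {0..x}) (\<lambda>t. cmod (\<phi> (x - t) *\<^sub>R r t))"
    proof (rule Bochner_Integration.integrable_bound[of _ "\<lambda>t. K * cmod (r t)"])
      show "integrable (lebesgue_on {0..x}) (\<lambda>t. K * cmod (r t))" using i by auto
      show "AE t in lebesgue_on {0..x}. norm (cmod (\<phi> (x - t) *\<^sub>R r t)) \<le> norm (K * cmod (r t))"
        using le K0 by (intro AE_I2) (simp add: abs_mult)
    qed (use m in measurable)
    have "cmod (LINT t|lebesgue_on {0..x}. \<phi> (x - t) *\<^sub>R r t) \<le> (LINT t|lebesgue_on {0..x}. cmod (\<phi> (x - t) *\<^sub>R r t))"
      by (rule integral_norm_bound)
    also have "\<dots> \<le> (LINT t|lebesgue_on {0..x}. K * cmod (r t))"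
      by (rule Bochner_Integration.integral_mono[OF i2]) (use i le in auto)
    also have "\<dots> = K * (LINT t|lebesgue_on {0..x}. cmod (r t))" by simp
    also have "\<dots> \<le> K * (LINT t|lebesgue_on {0..l}. cmod (r t))"
      using x by (intro mult_left_mono K0 integral_mono_lebesgue_on_AE integrable_norm L2_interval_integrable r AE_I2) auto
    also have "\<dots> \<le> K * (sqrt l * sqrt (LINT t|lebesgue_on {0..l}. (cmod (r t))\<^sup>2))"
      by (intro mult_left_mono K0 L2_interval_norm_bound r l)
    finally show "cmod (LINT t|lebesgue_on {0..x}. \<phi> (x - t) *\<^sub>R r t) \<le>
        K * sqrt l * sqrt (LINT t|lebesgue_on {0..l}. (cmod (r t))\<^sup>2)" by (simp add: mult.assoc)
  qed
qed

lemma convolution_AE_zero: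
  assumes "AE t in lebesgue_on {0..l}. r t = (0 :: complex)"
  shows "sin_conv lam l r = 0" "cos_conv lam l r = 0"
proof -
  show "sin_conv lam l r = 0" "cos_conv lam l r = 0"
    unfolding sin_conv_def cos_conv_def using assms by (auto intro!: integral_eq_zero_AE elim!: AE_mp)
qed

lemma H1_deriv_source_L2:
  assumes "H1_deriv l f h" "H1_deriv l h g"
  shows "(\<lambda>t. g t + complex_of_real lam * f t) \<in> L2_interval l"
  by (rule L2_interval_add[OF H1_derivD(1)[OF assms(2)] L2_interval_continuous])
     (rule continuous_on_mult_left[OF H1_deriv_continuous[OF assms(1)]])

text \<open>The contributions of the source to the outward derivatives in \<open>boundary_derivatives\<close> depend boundedly on
  the \<open>L\<^sup>2\<close> norm of the source.\<close>

lemma boundary_terms_bound: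
  assumes l: "0 < l"
  shows "\<exists>K\<ge>0. \<forall>r\<in>L2_interval l.
     cmod ((1 / sin_sol lam l) *\<^sub>R sin_conv lam l r) \<le> K * sqrt (LINT t|lebesgue_on {0..l}. (cmod (r t))\<^sup>2) \<and>
     cmod (cos_conv lam l r - (cos_sol lam l / sin_sol lam l) *\<^sub>R sin_conv lam l r)
       \<le> K * sqrt (LINT t|lebesgue_on {0..l}. (cmod (r t))\<^sup>2)"
proof -
  let ?n = "\<lambda>r. sqrt (LINT t|lebesgue_on {0..l}. (cmod (r t))\<^sup>2)"
  have lI: "l \<in> {0..l}" using l by simp
  have "continuous_on UNIV (sin_sol lam)" by (intro continuous_intros)
  from convolution_bound[OF this l] obtain K1 where K1: "0 \<le> K1"
    "\<And>r. r \<in> L2_interval l \<Longrightarrow> cmod (sin_conv lam l r) \<le> K1 * ?n r"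
    unfolding sin_conv_def using lI by blast
  have "continuous_on UNIV (cos_sol lam)" by (intro continuous_intros)
  from convolution_bound[OF this l] obtain K2 where K2: "0 \<le> K2"
    "\<And>r. r \<in> L2_interval l \<Longrightarrow> cmod (cos_conv lam l r) \<le> K2 * ?n r"
    unfolding cos_conv_def using lI by blast
  define K where "K = \<bar>1 / sin_sol lam l\<bar> * K1 + K2 + \<bar>cos_sol lam l / sin_sol lam l\<bar> * K1"
  have K0: "0 \<le> K" using K1 K2 by (simp add: K_def)
  have "cmod ((1 / sin_sol lam l) *\<^sub>R sin_conv lam l r) \<le> K * ?n r \<and>
     cmod (cos_conv lam l r - (cos_sol lam l / sin_sol lam l) *\<^sub>R sin_conv lam l r) \<le> K * ?n r"
    if r: "r \<in> L2_interval l" for r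
  proof -
    have n: "0 \<le> ?n r" by (intro real_sqrt_ge_zero Bochner_Integration.integral_nonneg) auto
    have 1: "cmod ((1 / sin_sol lam l) *\<^sub>R sin_conv lam l r) \<le> \<bar>1 / sin_sol lam l\<bar> * (K1 * ?n r)"
      unfolding norm_scaleR by (intro mult_left_mono K1(2) r) auto
    have 2: "cmod ((cos_sol lam l / sin_sol lam l) *\<^sub>R sin_conv lam l r) \<le> \<bar>cos_sol lam l / sin_sol lam l\<bar> * (K1 * ?n r)"
      unfolding norm_scaleR by (intro mult_left_mono K1(2) r) auto
    have 3: "0 \<le> K2 * ?n r" "0 \<le> \<bar>cos_sol lam l / sin_sol lam l\<bar> * (K1 * ?n r)" "0 \<le> \<bar>1 / sin_sol lam l\<bar> * (K1 * ?n r)"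
      using K1 K2 n by simp_all
    have eq: "K * ?n r = \<bar>1 / sin_sol lam l\<bar> * (K1 * ?n r) + K2 * ?n r + \<bar>cos_sol lam l / sin_sol lam l\<bar> * (K1 * ?n r)"
      by (simp add: K_def algebra_simps)
    show ?thesis unfolding eq
      using 1 2 3 K2(2)[OF r] norm_triangle_ineq4[of "cos_conv lam l r" "(cos_sol lam l / sin_sol lam l) *\<^sub>R sin_conv lam l r"]
      by linarith
  qed
  with K0 show ?thesis by blast
qed

text \<open>The boundary values and the source control \<open>f' 0\<close>, and then Duhamel's formula controls \<open>f\<close>.\<close>

lemma edge_bound:
  assumes l: "0 < l" and S: "sin_sol lam l \<noteq> 0"
  shows "\<exists>K\<ge>0. \<forall>f h g. H1_deriv l f h \<longrightarrow> H1_deriv l h g \<longrightarrow> (\<forall>x\<in>{0..l}. cmod (f x) \<le> K * (cmod (f 0) + cmod (f l) +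
     sqrt (LINT t|lebesgue_on {0..l}. (cmod (g t + complex_of_real lam * f t))\<^sup>2)))"
proof -
  let ?n = "\<lambda>r. sqrt (LINT t|lebesgue_on {0..l}. (cmod (r t))\<^sup>2)"
  have "compact (sin_sol lam ` {0..l})" by (intro compact_continuous_image continuous_intros) simp
  then have "bounded (sin_sol lam ` {0..l})" by (rule compact_imp_bounded)
  then obtain M1 where M1: "\<And>x. x \<in> {0..l} \<Longrightarrow> \<bar>sin_sol lam x\<bar> \<le> M1"
    unfolding bounded_iff real_norm_def ball_simps by blast
  have "compact (cos_sol lam ` {0..l})" by (intro compact_continuous_image continuous_intros) simp
  then have "bounded (cos_sol lam ` {0..l})" by (rule compact_imp_bounded)
  then obtain M2 where M2: "\<And>x. x \<in> {0..l} \<Longrightarrow> \<bar>cos_sol lam x\<bar> \<le> M2"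
    unfolding bounded_iff real_norm_def ball_simps by blast
  note M = M1 M2
  have M0: "0 \<le> M1" "0 \<le> M2" using M1[of 0] M2[of 0] l by auto
  have "continuous_on UNIV (sin_sol lam)" by (intro continuous_intros)
  from convolution_bound[OF this l] obtain K1 where
    K1: "0 \<le> K1" "\<And>r x. r \<in> L2_interval l \<Longrightarrow> x \<in> {0..l} \<Longrightarrow> cmod (sin_conv lam x r) \<le> K1 * ?n r"
    unfolding sin_conv_def by blast
  obtain K2 where K2: "0 \<le> K2" "\<And>r. r \<in> L2_interval l \<Longrightarrow> cmod ((1 / sin_sol lam l) *\<^sub>R sin_conv lam l r) \<le> K2 * ?n r"
    using boundary_terms_bound[OF l, of lam] by blast
  define a where "a = \<bar>1 / sin_sol lam l\<bar>"
  define c where "c = \<bar>cos_sol lam l\<bar>"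
  have ac: "0 \<le> a" "0 \<le> c" by (auto simp: a_def c_def)
  define K where "K = M2 + M1 * (a * c + a + K2) + K1"
  have K0: "0 \<le> K" using M0 K1 K2 ac by (simp add: K_def)
  have "cmod (f x) \<le> K * (cmod (f 0) + cmod (f l) + ?n (\<lambda>t. g t + complex_of_real lam * f t))"
    if f: "H1_deriv l f h" and h: "H1_deriv l h g" and x: "x \<in> {0..l}" for f h g x
  proof -
    let ?r = "\<lambda>t. g t + complex_of_real lam * f t"
    define N where "N = cmod (f 0) + cmod (f l) + ?n ?r"
    have r: "?r \<in> L2_interval l" by (rule H1_deriv_source_L2[OF f h])
    have n: "0 \<le> ?n ?r" by (intro real_sqrt_ge_zero Bochner_Integration.integral_nonneg) auto
    have N: "cmod (f 0) \<le> N" "cmod (f l) \<le> N" "?n ?r \<le> N" "0 \<le> N" using n by (auto simp: N_def)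
    have "cmod (h 0) = cmod (- h 0)" by simp
    also have "\<dots> \<le> a * cmod (cos_sol lam l *\<^sub>R f 0 - f l) + K2 * ?n ?r"
      unfolding boundary_derivatives(1)[OF f h less_imp_le[OF l] S refl]
      by (intro order_trans[OF norm_triangle_ineq] add_mono K2(2) r) (simp add: a_def)
    also have "cmod (cos_sol lam l *\<^sub>R f 0 - f l) \<le> c * cmod (f 0) + cmod (f l)"
      by (rule order_trans[OF norm_triangle_ineq4]) (simp add: c_def)
    also have "\<dots> \<le> c * N + N" by (intro add_mono mult_left_mono N ac)
    also have "a * (c * N + N) + K2 * ?n ?r \<le> a * (c * N + N) + K2 * N"
      by (intro add_left_mono mult_left_mono N K2)
    also have "\<dots> = (a * c + a + K2) * N" by (simp add: algebra_simps)
    finally have h0: "cmod (h 0) \<le> (a * c + a + K2) * N" using ac by (simp add: mult_left_mono)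
    have "cmod (f x) \<le> cmod (cos_sol lam x *\<^sub>R f 0) + cmod (sin_sol lam x *\<^sub>R h 0) + cmod (sin_conv lam x ?r)"
      using norm_triangle_ineq[of "cos_sol lam x *\<^sub>R f 0 + sin_sol lam x *\<^sub>R h 0" "sin_conv lam x ?r"]
        norm_triangle_ineq[of "cos_sol lam x *\<^sub>R f 0" "sin_sol lam x *\<^sub>R h 0"]
        arg_cong[OF duhamel(1)[OF f h x, of lam], of cmod] by linarith
    also have "cmod (cos_sol lam x *\<^sub>R f 0) \<le> M2 * N"
      unfolding norm_scaleR by (intro mult_mono M x N M0) auto
    also have "cmod (sin_sol lam x *\<^sub>R h 0) \<le> M1 * ((a * c + a + K2) * N)"
      unfolding norm_scaleR by (intro mult_mono M x h0 M0) auto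
    also have "cmod (sin_conv lam x ?r) \<le> K1 * N"
      using K1(2)[OF r x] mult_left_mono[OF N(3) K1(1)] by linarith
    finally show ?thesis by (simp add: K_def N_def algebra_simps)
  qed
  with K0 show ?thesis by blast
qed


section \<open>The vertex operator\<close>

definition opposite :: "'v quantum_graph \<Rightarrow> 'v set \<Rightarrow> 'v \<Rightarrow> 'v" where
  "opposite G e v = (if v = lend G e then rend G e else lend G e)"

definition incident :: "'v quantum_graph \<Rightarrow> 'v \<Rightarrow> 'v set set" where
  "incident G v = {e \<in> edges G. v \<in> e}"

text \<open>The outer normal derivative at \<open>v\<close> of the solution of \<open>u'' = - lam u\<close> with the vertex values \<open>y\<close>. Real vectors
  serve for sign arguments, complex ones for the traces of functions on the graph.\<close>

definition vertex_op :: "'v quantum_graph \<Rightarrow> real \<Rightarrow> ('v \<Rightarrow> 'a::real_vector) \<Rightarrow> 'v \<Rightarrow> 'a" where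
  "vertex_op G lam y v = (\<Sum>e\<in>incident G v.
     (1 / sin_sol lam (len G e)) *\<^sub>R (cos_sol lam (len G e) *\<^sub>R y v - y (opposite G e v)))"

text \<open>What a source \<open>r = f'' + lam f\<close> adds to the outer normal derivative of \<open>f\<close>, see \<open>normal_deriv_eq\<close>.\<close>

definition boundary_defect :: "'v quantum_graph \<Rightarrow> real \<Rightarrow> 'v gfun \<Rightarrow> 'v \<Rightarrow> complex" where
  "boundary_defect G lam r v =
     (\<Sum>e\<in>{e \<in> edges G. lend G e = v}. (1 / sin_sol lam (len G e)) *\<^sub>R sin_conv lam (len G e) (r e)) +
     (\<Sum>e\<in>{e \<in> edges G. rend G e = v}. cos_conv lam (len G e) (r e)
        - (cos_sol lam (len G e) / sin_sol lam (len G e)) *\<^sub>R sin_conv lam (len G e) (r e))"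

text \<open>The positive vector \<open>x\<close> is a strict supersolution on the inner vertices; its existence says that the inner
  block of the vertex operator, a matrix with nonpositive off-diagonal entries, is a nonsingular M-matrix.\<close>

definition admissible :: "'v quantum_graph \<Rightarrow> 'v set \<Rightarrow> real \<Rightarrow> bool" where
  "admissible G Vo lam \<longleftrightarrow> (\<forall>e\<in>edges G. 0 < sin_sol lam (len G e)) \<and>
     (\<exists>x :: 'v \<Rightarrow> real. (\<forall>v\<in>Vo. x v = 0) \<and> (\<forall>v\<in>verts G - Vo. 0 < x v \<and> 0 < vertex_op G lam x v))"

locale outer_vertices = connected_quantum_graph G for G :: "'v quantum_graph" +
  fixes Vo :: "'v set"
  assumes Vo_verts: "Vo \<subseteq> verts G"

begin

abbreviation Vi :: "'v set" where "Vi \<equiv> verts G - Vo"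

lemma finite_edges: "finite (edges G)"
  using edges_simple finite_verts by (intro finite_subset[of "edges G" "Pow (verts G)"]) auto

lemma finite_incident: "finite (incident G v)"
  using finite_edges by (simp add: incident_def)

lemma lend_neq_rend: "e \<in> edges G \<Longrightarrow> lend G e \<noteq> rend G e"
  using edges_simple[of e] edge_ends[of e] by (metis card_2_iff insert_absorb2 is_singletonI is_singleton_altdef numeral_eq_one_iff semiring_norm(85))

lemma in_edge_iff: "e \<in> edges G \<Longrightarrow> v \<in> e \<longleftrightarrow> v = lend G e \<or> v = rend G e"
  using edge_ends[of e] by auto

lemma ends_in_verts: "e \<in> edges G \<Longrightarrow> lend G e \<in> verts G" "e \<in> edges G \<Longrightarrow> rend G e \<in> verts G"
  using edges_simple[of e] in_edge_iff[of e] by auto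

lemma opposite_lend [simp]: "opposite G e (lend G e) = rend G e"
  by (simp add: opposite_def)

lemma opposite_rend: "e \<in> edges G \<Longrightarrow> opposite G e (rend G e) = lend G e"
  using lend_neq_rend[of e] by (auto simp: opposite_def)

lemma opposite_in_verts: "e \<in> incident G v \<Longrightarrow> opposite G e v \<in> verts G"
  using ends_in_verts by (auto simp: opposite_def incident_def)

lemma edge_opposite: "{v, w} \<in> edges G \<Longrightarrow> {v, w} \<in> incident G v \<and> opposite G {v, w} v = w"
  using edge_ends[of "{v, w}"] lend_neq_rend[of "{v, w}"]
  by (auto simp: incident_def opposite_def doubleton_eq_iff)

lemma incident_nonempty:
  assumes v: "v \<in> verts G" shows "incident G v \<noteq> {}"
proof -
  obtain e where e: "e \<in> edges G" using edges_nonempty by auto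
  show ?thesis
  proof (cases "v = lend G e")
    case True
    then show ?thesis using e in_edge_iff[OF e] by (auto simp: incident_def)
  next
    case False
    from connected[OF v ends_in_verts(1)[OF e]] False obtain w where "{v, w} \<in> edges G"
      by (auto elim: converse_rtranclE)
    then show ?thesis using edge_opposite by blast
  qed
qed

text \<open>There are no loops, so an edge starts or ends at a given end point, and not both.\<close>

lemma sum_incident:
  "(\<Sum>e\<in>incident G v. \<Phi> e) = (\<Sum>e\<in>{e \<in> edges G. lend G e = v}. \<Phi> e) + (\<Sum>e\<in>{e \<in> edges G. rend G e = v}. \<Phi> e)"
proof -
  have "incident G v = {e \<in> edges G. lend G e = v} \<union> {e \<in> edges G. rend G e = v}"
    using in_edge_iff by (auto simp: incident_def)
  moreover have "{e \<in> edges G. lend G e = v} \<inter> {e \<in> edges G. rend G e = v} = {}"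
    using lend_neq_rend by force
  ultimately show ?thesis using finite_edges by (simp add: sum.union_disjoint)
qed

lemma vertex_op_cong:
  assumes "\<And>u. u \<in> verts G \<Longrightarrow> y u = y' u" "v \<in> verts G"
  shows "vertex_op G lam y v = vertex_op G lam y' v"
  unfolding vertex_op_def by (intro sum.cong refl) (simp add: assms opposite_in_verts)

lemma vertex_op_add: "vertex_op G lam (\<lambda>u. y u + z u) v = vertex_op G lam y v + vertex_op G lam z v"
  unfolding vertex_op_def by (simp flip: sum.distrib add: algebra_simps)

lemma vertex_op_scaleR: "vertex_op G lam (\<lambda>u. c *\<^sub>R y u) v = c *\<^sub>R vertex_op G lam y v"
  unfolding vertex_op_def by (simp add: scaleR_sum_right algebra_simps)

lemma vertex_op_zero: "vertex_op G lam (\<lambda>_. 0) v = 0"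
  by (simp add: vertex_op_def)

lemma vertex_op_sum: "vertex_op G lam (\<lambda>u. \<Sum>w\<in>W. y w u) v = (\<Sum>w\<in>W. vertex_op G lam (y w) v)"
  by (induction W rule: infinite_finite_induct) (simp_all add: vertex_op_zero vertex_op_add)

lemma vertex_op_diff: "vertex_op G lam (\<lambda>u. y u - z u) v = vertex_op G lam y v - vertex_op G lam z v"
  unfolding vertex_op_def by (simp flip: sum_subtractf add: algebra_simps)

lemma Re_vertex_op: "Re (vertex_op G lam y v) = vertex_op G lam (\<lambda>u. Re (y u)) v"
  and Im_vertex_op: "Im (vertex_op G lam y v) = vertex_op G lam (\<lambda>u. Im (y u)) v"
  by (simp_all add: vertex_op_def Re_sum Im_sum)

lemma vertex_op_of_real:
  "vertex_op G lam (\<lambda>u. complex_of_real (y u)) v = complex_of_real (vertex_op G lam y v)"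
  by (simp add: complex_eq_iff Re_vertex_op Im_vertex_op vertex_op_zero)

text \<open>At a zero of a nonnegative vector only the off-diagonal entries contribute. Applied with sign information
  on the vertex operator, the second statement spreads positivity along edges.\<close>

lemma vertex_op_at_zero:
  assumes S: "\<And>e. e \<in> edges G \<Longrightarrow> 0 < sin_sol lam (len G e)"
    and y: "\<And>u. u \<in> verts G \<Longrightarrow> 0 \<le> (y u :: real)" and "y v = 0"
  shows vertex_op_nonpos: "vertex_op G lam y v \<le> 0"
    and vertex_op_neg: "e \<in> incident G v \<Longrightarrow> 0 < y (opposite G e v) \<Longrightarrow> vertex_op G lam y v < 0"
proof -
  have eq: "vertex_op G lam y v = - (\<Sum>e\<in>incident G v. y (opposite G e v) / sin_sol lam (len G e))"
    by (simp add: vertex_op_def \<open>y v = 0\<close> sum_negf)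
  have nn: "0 \<le> y (opposite G e v) / sin_sol lam (len G e)" if "e \<in> incident G v" for e
    using y[OF opposite_in_verts[OF that]] S[of e] that by (auto simp: incident_def)
  show "vertex_op G lam y v \<le> 0" unfolding eq using sum_nonneg[OF nn] by simp
  show "vertex_op G lam y v < 0" if e: "e \<in> incident G v" "0 < y (opposite G e v)"
  proof -
    have "0 < y (opposite G e v) / sin_sol lam (len G e)"
      using e S[of e] by (auto simp: incident_def)
    then show ?thesis unfolding eq using sum_pos2[OF finite_incident e(1) _ nn] by simp
  qed
qed

lemma admissible_sin_sol: "admissible G Vo lam \<Longrightarrow> e \<in> edges G \<Longrightarrow> 0 < sin_sol lam (len G e)"
  by (simp add: admissible_def)

text \<open>The maximum principle. If \<open>y\<close> were negative somewhere, subtract from it the least multiple \<open>t x\<close> with \<open>t < 0\<close>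
  of the supersolution \<open>x\<close> that still lies below \<open>y\<close>: at the inner vertex where the two touch, the vertex operator
  of the difference is not positive, but \<open>vertex_op y \<ge> 0 > t * vertex_op x\<close> there.\<close>

lemma comparison:
  assumes adm: "admissible G Vo lam" and yo: "\<And>v. v \<in> Vo \<Longrightarrow> 0 \<le> (y v :: real)"
    and yi: "\<And>v. v \<in> Vi \<Longrightarrow> 0 \<le> vertex_op G lam y v" and v: "v \<in> verts G"
  shows "0 \<le> y v"
proof (rule ccontr)
  assume neg: "\<not> 0 \<le> y v"
  from adm obtain x :: "'v \<Rightarrow> real" where S: "\<And>e. e \<in> edges G \<Longrightarrow> 0 < sin_sol lam (len G e)"
    and xo: "\<And>v. v \<in> Vo \<Longrightarrow> x v = 0" and x: "\<And>v. v \<in> Vi \<Longrightarrow> 0 < x v" "\<And>v. v \<in> Vi \<Longrightarrow> 0 < vertex_op G lam x v"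
    unfolding admissible_def by blast
  have vi: "v \<in> Vi" using neg yo v by auto
  \<comment> \<open>The largest \<open>t\<close> with \<open>t x \<le> y\<close> on the inner vertices; \<open>u\<close> is a vertex where equality holds.\<close>
  define t where "t = Min ((\<lambda>u. y u / x u) ` Vi)"
  have fin: "finite ((\<lambda>u. y u / x u) ` Vi)" using finite_verts by simp
  have t_le: "t \<le> y u / x u" if "u \<in> Vi" for u using fin that by (simp add: t_def)
  have "t \<in> (\<lambda>u. y u / x u) ` Vi" unfolding t_def using fin vi by (intro Min_in) auto
  then obtain u where u: "u \<in> Vi" "t = y u / x u" by auto
  have "y v / x v < 0" using neg x(1)[OF vi] by (simp add: divide_neg_pos)
  with t_le[OF vi] have t0: "t < 0" by linarith
  let ?z = "\<lambda>w. y w - t *\<^sub>R x w"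
  have "0 \<le> ?z w" if "w \<in> verts G" for w
  proof (cases "w \<in> Vo")
    case False
    with that have "w \<in> Vi" by simp
    from t_le[OF this] x(1)[OF this] show ?thesis by (simp add: pos_le_divide_eq)
  qed (simp add: xo yo)
  moreover have "?z u = 0" using u x(1)[OF u(1)] by simp
  ultimately have "vertex_op G lam ?z u \<le> 0" by (intro vertex_op_nonpos[OF S])
  then have "vertex_op G lam y u \<le> t * vertex_op G lam x u"
    unfolding vertex_op_diff vertex_op_scaleR by simp
  also have "\<dots> < 0" using t0 x(2)[OF u(1)] by (rule mult_neg_pos)
  finally show False using yi[OF u(1)] by simp
qed

text \<open>The unknowns are the values at the inner vertices; the prescribed values \<open>x\<close> at the outer vertices go to the
  right-hand side.\<close>

lemma vertex_problem_solvable: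
  assumes inj: "\<And>y :: 'v \<Rightarrow> real. (\<And>v. v \<in> Vo \<Longrightarrow> y v = 0) \<Longrightarrow> (\<And>v. v \<in> Vi \<Longrightarrow> vertex_op G lam y v = 0)
      \<Longrightarrow> \<forall>v\<in>Vi. y v = 0"
  shows "\<exists>y :: 'v \<Rightarrow> real. (\<forall>v\<in>Vo. y v = x v) \<and> (\<forall>v\<in>Vi. vertex_op G lam y v = b v)"
proof -
  define a where "a v w = vertex_op G lam (\<lambda>u. if u = w then 1 else 0 :: real) v" for v w
  define ext where "ext z u = (if u \<in> Vi then z u else 0)" for z :: "'v \<Rightarrow> real" and u
  have a: "(\<Sum>w\<in>Vi. a v w * z w) = vertex_op G lam (ext z) v" for z v
  proof -
    have "ext z = (\<lambda>u. \<Sum>w\<in>Vi. z w *\<^sub>R (if u = w then 1 else 0))"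
      using finite_verts by (auto simp: ext_def if_distrib[of "\<lambda>x. _ * x"] cong: if_cong)
    then have "vertex_op G lam (ext z) v = (\<Sum>w\<in>Vi. z w * a v w)"
      by (simp only: vertex_op_sum vertex_op_scaleR a_def) simp
    then show ?thesis by (simp add: mult.commute)
  qed
  have "\<exists>z. \<forall>v\<in>Vi. (\<Sum>w\<in>Vi. a v w * z w) = b v - vertex_op G lam (\<lambda>u. if u \<in> Vo then x u else 0) v"
  proof (rule injective_system_solvable)
    fix z assume "\<And>v. v \<in> Vi \<Longrightarrow> (\<Sum>w\<in>Vi. a v w * z w) = 0"
    then have "\<forall>v\<in>Vi. ext z v = 0" unfolding a by (intro inj) (simp add: ext_def)
    then show "\<forall>v\<in>Vi. z v = 0" by (simp add: ext_def)
  qed (use finite_verts in simp)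
  then obtain z where z: "\<And>v. v \<in> Vi \<Longrightarrow>
      vertex_op G lam (ext z) v = b v - vertex_op G lam (\<lambda>u. if u \<in> Vo then x u else 0) v"
    unfolding a by blast
  show ?thesis
  proof (intro exI[of _ "\<lambda>u. ext z u + (if u \<in> Vo then x u else 0)"] conjI ballI)
    fix v assume "v \<in> Vi"
    then show "vertex_op G lam (\<lambda>u. ext z u + (if u \<in> Vo then x u else 0)) v = b v"
      unfolding vertex_op_add by (simp add: z)
  qed (simp add: ext_def)
qed

lemma admissible_injective:
  assumes adm: "admissible G Vo lam" and o: "\<And>v. v \<in> Vo \<Longrightarrow> (y v :: real) = 0"
    and i: "\<And>v. v \<in> Vi \<Longrightarrow> vertex_op G lam y v = 0" and v: "v \<in> verts G"
  shows "y v = 0"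
proof -
  have "0 \<le> c *\<^sub>R y v" for c
  proof (rule comparison[OF adm _ _ v])
    show "0 \<le> c *\<^sub>R y u" if "u \<in> Vo" for u by (simp add: o that)
    show "0 \<le> vertex_op G lam (\<lambda>u. c *\<^sub>R y u) u" if "u \<in> Vi" for u
      unfolding vertex_op_scaleR i[OF that] by simp
  qed
  from this[of 1] this[of "-1"] show ?thesis by simp
qed

lemma admissible_solvable:
  assumes adm: "admissible G Vo lam"
  shows "\<exists>y :: 'v \<Rightarrow> real. (\<forall>v\<in>Vo. y v = x v) \<and> (\<forall>v\<in>Vi. vertex_op G lam y v = b v)"
proof (rule vertex_problem_solvable)
  fix y :: "'v \<Rightarrow> real"
  assume "\<And>v. v \<in> Vo \<Longrightarrow> y v = 0" "\<And>v. v \<in> Vi \<Longrightarrow> vertex_op G lam y v = 0"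
  from admissible_injective[OF adm this] show "\<forall>v\<in>Vi. y v = 0" by simp
qed

lemma admissible_solvable_complex:
  assumes adm: "admissible G Vo lam"
  shows "\<exists>y :: 'v \<Rightarrow> complex. (\<forall>v\<in>Vo. y v = x v) \<and> (\<forall>v\<in>Vi. vertex_op G lam y v = b v)"
proof -
  from admissible_solvable[OF adm, of "\<lambda>v. Re (x v)" "\<lambda>v. Re (b v)"] obtain y1 :: "'v \<Rightarrow> real" where
    1: "\<forall>v\<in>Vo. y1 v = Re (x v)" "\<forall>v\<in>Vi. vertex_op G lam y1 v = Re (b v)" by blast
  from admissible_solvable[OF adm, of "\<lambda>v. Im (x v)" "\<lambda>v. Im (b v)"] obtain y2 :: "'v \<Rightarrow> real" where
    2: "\<forall>v\<in>Vo. y2 v = Im (x v)" "\<forall>v\<in>Vi. vertex_op G lam y2 v = Im (b v)" by blast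
  show ?thesis
    using 1 2 by (intro exI[of _ "\<lambda>v. Complex (y1 v) (y2 v)"])
      (auto simp: complex_eq_iff Re_vertex_op Im_vertex_op)
qed

lemma admissible_injective_complex:
  assumes adm: "admissible G Vo lam" and o: "\<And>v. v \<in> Vo \<Longrightarrow> (y v :: complex) = 0"
    and i: "\<And>v. v \<in> Vi \<Longrightarrow> vertex_op G lam y v = 0" and v: "v \<in> verts G"
  shows "y v = 0"
proof (rule complex_eqI)
  have "Re (y v) = 0"
    by (rule admissible_injective[OF adm _ _ v]) (simp_all only: o Re_vertex_op[symmetric] i zero_complex.sel)
  then show "Re (y v) = Re 0" by simp
  have "Im (y v) = 0"
    by (rule admissible_injective[OF adm _ _ v]) (simp_all only: o Im_vertex_op[symmetric] i zero_complex.sel)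
  then show "Im (y v) = Im 0" by simp
qed

text \<open>A large multiple of the supersolution dominates both \<open>u\<close> and \<open>- u\<close> by the maximum principle.\<close>

lemma vertex_op_stability:
  assumes adm: "admissible G Vo lam"
  shows "\<exists>T\<ge>0. \<forall>u b. 0 \<le> b \<longrightarrow> (\<forall>v\<in>Vo. u v = (0 :: real)) \<longrightarrow> (\<forall>v\<in>Vi. \<bar>vertex_op G lam u v\<bar> \<le> b) \<longrightarrow>
    (\<forall>v\<in>verts G. \<bar>u v\<bar> \<le> T * b)"
proof -
  from adm obtain x :: "'v \<Rightarrow> real" where
    xo: "\<And>v. v \<in> Vo \<Longrightarrow> x v = 0" and x: "\<And>v. v \<in> Vi \<Longrightarrow> 0 < x v" "\<And>v. v \<in> Vi \<Longrightarrow> 0 < vertex_op G lam x v"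
    unfolding admissible_def by blast
  have fin: "finite Vi" using finite_verts by simp
  \<comment> \<open>\<open>A * x\<close> is mapped to a vector that is at least \<open>1\<close>, and \<open>B\<close> bounds \<open>x\<close>.\<close>
  define A where "A = (\<Sum>v\<in>Vi. 1 / vertex_op G lam x v)"
  define B where "B = (\<Sum>v\<in>Vi. x v)"
  have A0: "0 \<le> A" unfolding A_def by (intro sum_nonneg) (simp add: less_imp_le x)
  have B0: "0 \<le> B" unfolding B_def by (intro sum_nonneg) (simp add: less_imp_le x)
  have A: "1 \<le> A * vertex_op G lam x v" if v: "v \<in> Vi" for v
  proof -
    have "1 / vertex_op G lam x v \<le> A" unfolding A_def
      by (rule member_le_sum[OF v _ fin]) (simp add: less_imp_le x)
    with x(2)[OF v] show ?thesis by (simp add: divide_le_eq)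
  qed
  have B: "x v \<le> B" if v: "v \<in> verts G" for v
  proof (cases "v \<in> Vo")
    case False
    with v have v': "v \<in> Vi" by simp
    show ?thesis unfolding B_def by (rule member_le_sum[OF v' _ fin]) (simp add: less_imp_le x)
  qed (simp add: xo B0)
  have "\<bar>u v\<bar> \<le> A * B * b" if b: "0 \<le> b" and uo: "\<And>v. v \<in> Vo \<Longrightarrow> u v = (0 :: real)"
    and ui: "\<And>v. v \<in> Vi \<Longrightarrow> \<bar>vertex_op G lam u v\<bar> \<le> b" and v: "v \<in> verts G" for u b v
  proof -
    have "0 \<le> (A * b) *\<^sub>R x v - s *\<^sub>R u v" if s: "\<bar>s\<bar> = 1" for s
    proof (rule comparison[OF adm _ _ v])
      show "0 \<le> (A * b) *\<^sub>R x w - s *\<^sub>R u w" if "w \<in> Vo" for w using that by (simp add: xo uo)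
      fix w assume w: "w \<in> Vi"
      have "s * vertex_op G lam u w \<le> \<bar>s * vertex_op G lam u w\<bar>" by simp
      also have "\<dots> = \<bar>vertex_op G lam u w\<bar>" using s by (simp add: abs_mult)
      also have "\<dots> \<le> b * 1" using ui[OF w] by simp
      also have "\<dots> \<le> b * (A * vertex_op G lam x w)" by (rule mult_left_mono[OF A[OF w] b])
      finally show "0 \<le> vertex_op G lam (\<lambda>w. (A * b) *\<^sub>R x w - s *\<^sub>R u w) w"
        unfolding vertex_op_diff vertex_op_scaleR by (simp add: mult_ac)
    qed
    from this[of 1] this[of "-1"] have "\<bar>u v\<bar> \<le> A * b * x v" by simp
    also have "\<dots> \<le> A * b * B" using A0 b B[OF v] by (intro mult_left_mono) simp_all
    finally show ?thesis by (simp add: mult_ac)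
  qed
  with A0 B0 show ?thesis by (intro exI[of _ "A * B"]) simp
qed


section \<open>From the graph to its vertices\<close>

lemma vertex_trace_eq:
  assumes c: "continuous_across_vertices G f" and e: "e \<in> edges G"
  shows "vertex_trace G f (lend G e) = f e 0" "vertex_trace G f (rend G e) = f e (len G e)"
proof -
  have *: "vertex_trace G f v = vertex_value G f e v" if "v \<in> e" for v
    unfolding vertex_trace_def
  proof (rule the_equality)
    show "\<forall>e'\<in>edges G. v \<in> e' \<longrightarrow> vertex_value G f e' v = vertex_value G f e v"
      using c e that edges_simple[OF e] unfolding continuous_across_vertices_def by blast
  qed (use e that in blast)
  show "vertex_trace G f (lend G e) = f e 0" "vertex_trace G f (rend G e) = f e (len G e)"
    using *[of "lend G e"] *[of "rend G e"] in_edge_iff[OF e] lend_neq_rend[OF e]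
    by (auto simp: vertex_value_def)
qed

lemma Delta_max_derivatives:
  assumes "(f, g) \<in> Delta_max G"
  obtains h where "\<And>e. e \<in> edges G \<Longrightarrow> H1_deriv (len G e) (f e) (h e)"
    "\<And>e. e \<in> edges G \<Longrightarrow> H1_deriv (len G e) (h e) (g e)" "continuous_across_vertices G f"
proof -
  from assms have "\<forall>e\<in>edges G. \<exists>h. H1_deriv (len G e) (f e) h \<and> H1_deriv (len G e) h (g e)"
    and c: "continuous_across_vertices G f" by (auto simp: Delta_max_def H2_deriv2_def)
  from bchoice[OF this(1)] obtain h where
    "\<forall>e\<in>edges G. H1_deriv (len G e) (f e) (h e) \<and> H1_deriv (len G e) (h e) (g e)" ..
  with c show ?thesis by (intro that[of h]) blast+
qed

lemma Delta_maxI: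
  assumes "\<And>e. e \<in> edges G \<Longrightarrow> H1_deriv (len G e) (f e) (h e)"
    "\<And>e. e \<in> edges G \<Longrightarrow> H1_deriv (len G e) (h e) (g e)" "continuous_across_vertices G f"
  shows "(f, g) \<in> Delta_max G"
  using assms by (auto simp: Delta_max_def H2_deriv2_def)

lemma normal_deriv_derivatives:
  assumes fh: "\<And>e. e \<in> edges G \<Longrightarrow> H1_deriv (len G e) (f e) (h e)"
    and hg: "\<And>e. e \<in> edges G \<Longrightarrow> H1_deriv (len G e) (h e) (g e)"
  shows "normal_deriv G f v =
    (\<Sum>e\<in>{e \<in> edges G. lend G e = v}. - h e 0) + (\<Sum>e\<in>{e \<in> edges G. rend G e = v}. h e (len G e))"
proof -
  have vd: "vector_derivative (f e) (at x within {0..len G e}) = h e x"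
    if "e \<in> edges G" "x \<in> {0..len G e}" for e x
    by (intro vector_derivative_within_closed_interval len_pos that
        H1_deriv_has_vector_derivative[OF fh] H1_deriv_continuous[OF hg])
  show ?thesis
    unfolding normal_deriv_def sum_negf[symmetric]
    by (intro arg_cong2[of _ _ _ _ "(+)"] sum.cong refl) (simp_all add: vd less_imp_le[OF len_pos])
qed

text \<open>The reduction to the vertices: up to the contribution of the source, the outer normal derivative is the vertex
  operator applied to the trace.\<close>

lemma normal_deriv_eq:
  assumes fh: "\<And>e. e \<in> edges G \<Longrightarrow> H1_deriv (len G e) (f e) (h e)"
    and hg: "\<And>e. e \<in> edges G \<Longrightarrow> H1_deriv (len G e) (h e) (g e)"
    and c: "continuous_across_vertices G f"
    and S: "\<And>e. e \<in> edges G \<Longrightarrow> sin_sol lam (len G e) \<noteq> 0"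
  shows "normal_deriv G f v = vertex_op G lam (vertex_trace G f) v
      + boundary_defect G lam (\<lambda>e t. g e t + complex_of_real lam * f e t) v"
proof -
  let ?r = "\<lambda>e t. g e t + complex_of_real lam * f e t"
  note bd = boundary_derivatives[OF fh hg less_imp_le[OF len_pos] S refl]
  have "normal_deriv G f v = (\<Sum>e\<in>{e \<in> edges G. lend G e = v}. - h e 0) + (\<Sum>e\<in>{e \<in> edges G. rend G e = v}. h e (len G e))"
    by (rule normal_deriv_derivatives[OF fh hg])
  also have "(\<Sum>e\<in>{e \<in> edges G. lend G e = v}. - h e 0) = (\<Sum>e\<in>{e \<in> edges G. lend G e = v}.
      (1 / sin_sol lam (len G e)) *\<^sub>R (cos_sol lam (len G e) *\<^sub>R vertex_trace G f v - vertex_trace G f (opposite G e v))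
      + (1 / sin_sol lam (len G e)) *\<^sub>R sin_conv lam (len G e) (?r e))"
    by (intro sum.cong refl) (auto simp: bd(1) vertex_trace_eq[OF c])
  also have "(\<Sum>e\<in>{e \<in> edges G. rend G e = v}. h e (len G e)) = (\<Sum>e\<in>{e \<in> edges G. rend G e = v}.
      (1 / sin_sol lam (len G e)) *\<^sub>R (cos_sol lam (len G e) *\<^sub>R vertex_trace G f v - vertex_trace G f (opposite G e v))
      + (cos_conv lam (len G e) (?r e) - (cos_sol lam (len G e) / sin_sol lam (len G e)) *\<^sub>R sin_conv lam (len G e) (?r e)))"
    by (intro sum.cong refl) (auto simp: bd(2) vertex_trace_eq[OF c] opposite_rend)
  finally show ?thesis
    unfolding vertex_op_def boundary_defect_def sum_incident by (simp add: sum.distrib)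
qed

text \<open>On each edge the initial slope is chosen so that the solution of the initial value problem reaches the
  prescribed value at the other end; this is where \<open>sin_sol lam (len G e) \<noteq> 0\<close> enters.\<close>

lemma extension_exists:
  assumes r: "r \<in> L2_graph G" and S: "\<And>e. e \<in> edges G \<Longrightarrow> sin_sol lam (len G e) \<noteq> 0"
  shows "\<exists>f h. (\<forall>e\<in>edges G. H1_deriv (len G e) (f e) (h e)) \<and>
    (\<forall>e\<in>edges G. H1_deriv (len G e) (h e) (\<lambda>t. r e t - complex_of_real lam * f e t)) \<and>
    continuous_across_vertices G f \<and> (\<forall>v\<in>verts G. vertex_trace G f v = y v)"
proof -
  define Q where "Q e p \<longleftrightarrow> H1_deriv (len G e) (fst p) (snd p) \<and>
      H1_deriv (len G e) (snd p) (\<lambda>t. r e t - complex_of_real lam * fst p t)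
      \<and> fst p 0 = y (lend G e) \<and> fst p (len G e) = y (rend G e)" for e p
  have "\<forall>e\<in>edges G. \<exists>p. Q e p"
  proof
    fix e assume e: "e \<in> edges G"
    let ?l = "len G e"
    let ?C = "cos_sol lam ?l" and ?S = "sin_sol lam ?l" and ?P = "sin_conv lam ?l (r e)"
    have rL: "r e \<in> L2_interval ?l" using r e by (simp add: L2_graph_def)
    obtain f h where f: "H1_deriv ?l f h" and h: "H1_deriv ?l h (\<lambda>t. r e t - complex_of_real lam * f t)"
      and i: "f 0 = y (lend G e)" "h 0 = (1 / ?S) *\<^sub>R (y (rend G e) - ?C *\<^sub>R y (lend G e) - ?P)"
      by (rule variation_of_constants[OF rL])
    have "f ?l = y (rend G e)"
      using duhamel(1)[OF f h, of ?l lam] len_pos[OF e] S[OF e] i by simp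
    with f h i have "Q e (f, h)" by (simp add: Q_def)
    then show "\<exists>p. Q e p" ..
  qed
  from bchoice[OF this] obtain p where "\<forall>e\<in>edges G. Q e (p e)" ..
  then have p: "Q e (p e)" if "e \<in> edges G" for e using that by blast
  note p' = p[unfolded Q_def]
  let ?f = "\<lambda>e. fst (p e)"
  have val: "vertex_value G ?f e v = y v" if "e \<in> edges G" "v \<in> e" for e v
    using p'[OF that(1)] that in_edge_iff[OF that(1)] by (auto simp: vertex_value_def)
  have c: "continuous_across_vertices G ?f"
    unfolding continuous_across_vertices_def using val by simp
  have "vertex_trace G ?f v = y v" if v: "v \<in> verts G" for v
  proof -
    obtain e where e: "e \<in> edges G" "v \<in> e" using incident_nonempty[OF v] by (auto simp: incident_def)
    then show ?thesis using vertex_trace_eq[OF c e(1)] in_edge_iff[OF e(1)] p'[OF e(1)] by auto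
  qed
  with p' c show ?thesis by (intro exI[of _ ?f] exI[of _ "\<lambda>e. snd (p e)"]) simp
qed


section \<open>The resolvent\<close>

lemma L2_norm_nonneg: "0 \<le> L2_norm G r"
  unfolding L2_norm_def by (intro real_sqrt_ge_zero sum_nonneg Bochner_Integration.integral_nonneg) auto

lemma edge_L2_norm_le:
  assumes "e \<in> edges G"
  shows "sqrt (LINT x|lebesgue_on {0..len G e}. (cmod (r e x))\<^sup>2) \<le> L2_norm G r"
  unfolding L2_norm_def
proof (rule real_sqrt_le_mono)
  show "(LINT x|lebesgue_on {0..len G e}. (cmod (r e x))\<^sup>2) \<le>
      (\<Sum>e\<in>edges G. LINT x|lebesgue_on {0..len G e}. (cmod (r e x))\<^sup>2)"
    by (rule member_le_sum[OF assms _ finite_edges]) (rule Bochner_Integration.integral_nonneg, simp)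
qed

lemma L2_norm_cong_zero:
  assumes "L2_eq G r (\<lambda>e x. 0)" shows "L2_norm G r = 0"
proof -
  have "(LINT x|lebesgue_on {0..len G e}. (cmod (r e x))\<^sup>2) = 0" if "e \<in> edges G" for e
  proof (rule integral_eq_zero_AE)
    show "AE x in lebesgue_on {0..len G e}. (cmod (r e x))\<^sup>2 = 0"
      using assms that by (auto simp: L2_eq_def elim!: eventually_mono)
  qed
  then show ?thesis by (simp add: L2_norm_def)
qed

text \<open>The source controls the boundary defect, hence the vertex operator of the trace, hence by stability the trace,
  hence the function on every edge. The bound contains injectivity and boundedness of the inverse.\<close>

lemma a_priori_bound:
  assumes adm: "admissible G Vo lam"
  shows "\<exists>c\<ge>0. \<forall>f g. (f, g) \<in> Delta G Vo \<longrightarrow> (\<forall>e\<in>edges G. \<forall>x\<in>{0..len G e}.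
    cmod (f e x) \<le> c * L2_norm G (\<lambda>e x. g e x + complex_of_real lam * f e x))"
proof -
  let ?n = "\<lambda>e r. sqrt (LINT t|lebesgue_on {0..len G e}. (cmod (r t))\<^sup>2)"
  note S = admissible_sin_sol[OF adm]
  have "\<forall>e\<in>edges G. \<exists>K\<ge>0. \<forall>r\<in>L2_interval (len G e).
     cmod ((1 / sin_sol lam (len G e)) *\<^sub>R sin_conv lam (len G e) r) \<le> K * ?n e r \<and>
     cmod (cos_conv lam (len G e) r - (cos_sol lam (len G e) / sin_sol lam (len G e)) *\<^sub>R sin_conv lam (len G e) r)
       \<le> K * ?n e r"
    by (intro ballI boundary_terms_bound len_pos)
  from bchoice[OF this] obtain k where k: "\<forall>e\<in>edges G. 0 \<le> k e \<and> (\<forall>r\<in>L2_interval (len G e).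
     cmod ((1 / sin_sol lam (len G e)) *\<^sub>R sin_conv lam (len G e) r) \<le> k e * ?n e r \<and>
     cmod (cos_conv lam (len G e) r - (cos_sol lam (len G e) / sin_sol lam (len G e)) *\<^sub>R sin_conv lam (len G e) r)
       \<le> k e * ?n e r)" ..
  have "\<forall>e\<in>edges G. \<exists>K\<ge>0. \<forall>f h g. H1_deriv (len G e) f h \<longrightarrow> H1_deriv (len G e) h g \<longrightarrow>
     (\<forall>x\<in>{0..len G e}. cmod (f x) \<le> K * (cmod (f 0) + cmod (f (len G e)) + ?n e (\<lambda>t. g t + complex_of_real lam * f t)))"
    by (intro ballI edge_bound len_pos) (simp_all add: less_imp_neq[OF S, symmetric])
  from bchoice[OF this] obtain m where m: "\<forall>e\<in>edges G. 0 \<le> m e \<and> (\<forall>f h g. H1_deriv (len G e) f h \<longrightarrow>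
     H1_deriv (len G e) h g \<longrightarrow> (\<forall>x\<in>{0..len G e}. cmod (f x) \<le>
       m e * (cmod (f 0) + cmod (f (len G e)) + ?n e (\<lambda>t. g t + complex_of_real lam * f t))))" ..
  obtain T where T0: "0 \<le> T" and T1: "\<forall>u b. 0 \<le> b \<longrightarrow> (\<forall>v\<in>Vo. u v = (0 :: real)) \<longrightarrow>
      (\<forall>v\<in>Vi. \<bar>vertex_op G lam u v\<bar> \<le> b) \<longrightarrow> (\<forall>v\<in>verts G. \<bar>u v\<bar> \<le> T * b)"
    using vertex_op_stability[OF adm] by blast
  have T: "\<bar>u v\<bar> \<le> T * b" if "0 \<le> b" "\<And>v. v \<in> Vo \<Longrightarrow> u v = (0 :: real)"
      "\<And>v. v \<in> Vi \<Longrightarrow> \<bar>vertex_op G lam u v\<bar> \<le> b" "v \<in> verts G" for u b v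
    by (rule T1[rule_format]) (use that in simp_all)
  define K where "K = (\<Sum>e\<in>edges G. k e)"
  define M where "M = (\<Sum>e\<in>edges G. m e)"
  have K0: "0 \<le> K" unfolding K_def using k by (intro sum_nonneg) simp
  have mM: "m e \<le> M" if "e \<in> edges G" for e
    unfolding M_def by (rule member_le_sum[OF that _ finite_edges]) (use m in simp)
  have M0: "0 \<le> M" unfolding M_def using m by (intro sum_nonneg) simp
  have "cmod (f e x) \<le> M * (8 * T * K + 1) * L2_norm G (\<lambda>e x. g e x + complex_of_real lam * f e x)"
    if fg: "(f, g) \<in> Delta G Vo" and e: "e \<in> edges G" and x: "x \<in> {0..len G e}" for f g e x
  proof -
    from fg have "(f, g) \<in> Delta_max G" and o: "\<And>v. v \<in> Vo \<Longrightarrow> vertex_trace G f v = 0"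
      and i: "\<And>v. v \<in> Vi \<Longrightarrow> normal_deriv G f v = 0" by (auto simp: Delta_def)
    from Delta_max_derivatives[OF this(1)] obtain h where
      fh: "\<And>e. e \<in> edges G \<Longrightarrow> H1_deriv (len G e) (f e) (h e)" and
      hg: "\<And>e. e \<in> edges G \<Longrightarrow> H1_deriv (len G e) (h e) (g e)" and c: "continuous_across_vertices G f" by blast
    let ?r = "\<lambda>e x. g e x + complex_of_real lam * f e x"
    define \<rho> where "\<rho> = L2_norm G ?r"
    have \<rho>0: "0 \<le> \<rho>" by (simp add: \<rho>_def L2_norm_nonneg)
    have n\<rho>: "?n e (?r e) \<le> \<rho>" if "e \<in> edges G" for e unfolding \<rho>_def by (rule edge_L2_norm_le[OF that])
    have rL: "?r e \<in> L2_interval (len G e)" if "e \<in> edges G" for e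
      by (rule H1_deriv_source_L2[OF fh hg]) fact+
    have kn: "k e * ?n e (?r e) \<le> k e * \<rho>" if "e \<in> edges G" for e
      using n\<rho>[OF that] k that by (intro mult_left_mono) simp_all
    \<comment> \<open>Each of the two sums in the boundary defect runs over part of the edges.\<close>
    have part: "(\<Sum>e\<in>A. cmod (F e)) \<le> K * \<rho>"
      if "A \<subseteq> edges G" "\<And>e. e \<in> edges G \<Longrightarrow> cmod (F e) \<le> k e * ?n e (?r e)" for A and F :: "'v set \<Rightarrow> complex"
    proof -
      have "(\<Sum>e\<in>A. cmod (F e)) \<le> (\<Sum>e\<in>A. k e * \<rho>)"
        by (intro sum_mono order_trans[OF that(2) kn]) (use that(1) in blast)+
      also have "\<dots> \<le> (\<Sum>e\<in>edges G. k e * \<rho>)"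
        by (intro sum_mono2 finite_edges that(1) mult_nonneg_nonneg \<rho>0) (use k in simp)
      finally show ?thesis by (simp add: K_def sum_distrib_right)
    qed
    have defect: "cmod (boundary_defect G lam ?r v) \<le> 2 * K * \<rho>" for v
    proof -
      have "cmod (boundary_defect G lam ?r v) \<le> K * \<rho> + K * \<rho>"
        unfolding boundary_defect_def
        by (intro order_trans[OF norm_triangle_ineq] add_mono order_trans[OF norm_sum] part)
          (use k rL in simp_all)
      then show ?thesis by simp
    qed
    have op: "vertex_op G lam (vertex_trace G f) v = - boundary_defect G lam ?r v" if "v \<in> Vi" for v
    proof -
      have "normal_deriv G f v = vertex_op G lam (vertex_trace G f) v + boundary_defect G lam ?r v"
        by (rule normal_deriv_eq[OF fh hg c]) (use S in force)+
      with i[OF that] show ?thesis by (simp add: eq_neg_iff_add_eq_0)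
    qed
    have tr: "cmod (vertex_trace G f v) \<le> 4 * T * K * \<rho>" if v: "v \<in> verts G" for v
    proof -
      have b0: "0 \<le> 2 * K * \<rho>" using K0 \<rho>0 by simp
      have "\<bar>Re (vertex_trace G f v)\<bar> \<le> T * (2 * K * \<rho>)"
      proof (rule T[OF b0 _ _ v])
        show "\<bar>vertex_op G lam (\<lambda>v. Re (vertex_trace G f v)) w\<bar> \<le> 2 * K * \<rho>" if "w \<in> Vi" for w
          unfolding Re_vertex_op[symmetric] op[OF that] using defect[of w] abs_Re_le_cmod[of "- boundary_defect G lam ?r w"]
          by simp
      qed (simp add: o)
      moreover have "\<bar>Im (vertex_trace G f v)\<bar> \<le> T * (2 * K * \<rho>)"
      proof (rule T[OF b0 _ _ v])
        show "\<bar>vertex_op G lam (\<lambda>v. Im (vertex_trace G f v)) w\<bar> \<le> 2 * K * \<rho>" if "w \<in> Vi" for w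
          unfolding Im_vertex_op[symmetric] op[OF that] using defect[of w] abs_Im_le_cmod[of "- boundary_defect G lam ?r w"]
          by simp
      qed (simp add: o)
      ultimately show ?thesis using cmod_le[of "vertex_trace G f v"] by (simp add: algebra_simps)
    qed
    have "cmod (f e x) \<le> m e * (cmod (f e 0) + cmod (f e (len G e)) + ?n e (?r e))"
      using m e fh[OF e] hg[OF e] x by blast
    also have "\<dots> \<le> M * (4 * T * K * \<rho> + 4 * T * K * \<rho> + \<rho>)"
    proof (intro mult_mono mM e add_mono n\<rho> M0)
      show "cmod (f e 0) \<le> 4 * T * K * \<rho>"
        using tr[OF ends_in_verts(1)[OF e]] vertex_trace_eq(1)[OF c e] by simp
      show "cmod (f e (len G e)) \<le> 4 * T * K * \<rho>"
        using tr[OF ends_in_verts(2)[OF e]] vertex_trace_eq(2)[OF c e] by simp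
      show "0 \<le> cmod (f e 0) + cmod (f e (len G e)) + ?n e (?r e)"
        by (intro add_nonneg_nonneg real_sqrt_ge_zero Bochner_Integration.integral_nonneg) auto
    qed
    also have "\<dots> = M * (8 * T * K + 1) * \<rho>" by (simp add: algebra_simps)
    finally show ?thesis unfolding \<rho>_def .
  qed
  moreover have "0 \<le> M * (8 * T * K + 1)" using M0 K0 T0 by simp
  ultimately show ?thesis by blast
qed

lemma neg_opI: "(f, g) \<in> A \<Longrightarrow> (f, \<lambda>e x. - g e x) \<in> neg_op A"
  unfolding neg_op_def by blast

text \<open>Surjectivity: choose the vertex values so that the vertex operator compensates the boundary defect of the
  right-hand side at the inner vertices, and extend them to the edges.\<close>

lemma admissible_imp_resolvent:
  assumes adm: "admissible G Vo lam"
  shows "complex_of_real lam \<in> resolvent_set G (neg_op (Delta G Vo))"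
proof -
  let ?z = "complex_of_real lam"
  note S = admissible_sin_sol[OF adm]
  obtain c where c0: "0 \<le> c" and c: "\<And>f g e x. (f, g) \<in> Delta G Vo \<Longrightarrow> e \<in> edges G \<Longrightarrow> x \<in> {0..len G e} \<Longrightarrow>
    cmod (f e x) \<le> c * L2_norm G (\<lambda>e x. g e x + ?z * f e x)"
    using a_priori_bound[OF adm] by blast
  have eq: "(\<lambda>e x. ?z * f e x - - g e x) = (\<lambda>e x. g e x + ?z * f e x)" for f g :: "'v gfun"
    by (simp add: add.commute)
  have inj: "L2_eq G f (\<lambda>e x. 0)"
    if fg: "(f, g) \<in> Delta G Vo" and z: "L2_eq G (\<lambda>e x. ?z * f e x - - g e x) (\<lambda>e x. 0)" for f g
    unfolding L2_eq_def
  proof (intro ballI AE_I2)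
    fix e x assume "e \<in> edges G" "x \<in> space (lebesgue_on {0..len G e})"
    with c[OF fg, of e x] L2_norm_cong_zero[OF z] show "f e x = 0" unfolding eq by simp
  qed
  have surj: "\<exists>f g. (f, g) \<in> Delta G Vo \<and> L2_eq G (\<lambda>e x. ?z * f e x - - g e x) r"
    if r: "r \<in> L2_graph G" for r
  proof -
    obtain y :: "'v \<Rightarrow> complex" where yo: "\<forall>v\<in>Vo. y v = 0"
      and yi: "\<forall>v\<in>Vi. vertex_op G lam y v = - boundary_defect G lam r v"
      using admissible_solvable_complex[OF adm, of "\<lambda>_. 0" "\<lambda>v. - boundary_defect G lam r v"] by blast
    have S0: "\<And>e. e \<in> edges G \<Longrightarrow> sin_sol lam (len G e) \<noteq> 0" using S by force
    have "\<exists>f h. (\<forall>e\<in>edges G. H1_deriv (len G e) (f e) (h e)) \<and>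
      (\<forall>e\<in>edges G. H1_deriv (len G e) (h e) (\<lambda>t. r e t - ?z * f e t)) \<and>
      continuous_across_vertices G f \<and> (\<forall>v\<in>verts G. vertex_trace G f v = y v)"
      by (rule extension_exists[OF r]) (rule S0)
    then obtain f h where
      fh: "\<forall>e\<in>edges G. H1_deriv (len G e) (f e) (h e)" and
      hg: "\<forall>e\<in>edges G. H1_deriv (len G e) (h e) (\<lambda>t. r e t - ?z * f e t)" and
      ca: "continuous_across_vertices G f" and tr: "\<forall>v\<in>verts G. vertex_trace G f v = y v"
      by (elim exE conjE)
    note fh = fh[rule_format] and hg = hg[rule_format] and tr = tr[rule_format]
    let ?g = "\<lambda>e t. r e t - ?z * f e t"
    have "normal_deriv G f v = 0" if v: "v \<in> Vi" for v
    proof -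
      have "normal_deriv G f v = vertex_op G lam (vertex_trace G f) v
          + boundary_defect G lam (\<lambda>e t. ?g e t + ?z * f e t) v"
        by (rule normal_deriv_eq[OF fh hg ca S0])
      also have "(\<lambda>e t. ?g e t + ?z * f e t) = r" by simp
      also have "vertex_op G lam (vertex_trace G f) v = vertex_op G lam y v"
        by (rule vertex_op_cong) (use tr v in simp_all)
      finally show ?thesis using yi v by simp
    qed
    moreover have "vertex_trace G f v = 0" if "v \<in> Vo" for v using tr[of v] yo that Vo_verts by auto
    moreover have "(f, ?g) \<in> Delta_max G" by (rule Delta_maxI[OF fh hg ca])
    ultimately have "(f, ?g) \<in> Delta G Vo" by (simp add: Delta_def)
    moreover have "L2_eq G (\<lambda>e x. ?z * f e x - - ?g e x) r" by (simp add: L2_eq_def)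
    ultimately show ?thesis by blast
  qed
  define C where "C = c * sqrt (\<Sum>e\<in>edges G. len G e)"
  have bdd: "L2_norm G f \<le> C * L2_norm G (\<lambda>e x. ?z * f e x - - g e x)" if fg: "(f, g) \<in> Delta G Vo" for f g
  proof -
    define \<rho> where "\<rho> = L2_norm G (\<lambda>e x. g e x + ?z * f e x)"
    have \<rho>0: "0 \<le> \<rho>" by (simp add: \<rho>_def L2_norm_nonneg)
    from fg have "(f, g) \<in> Delta_max G" by (simp add: Delta_def)
    from Delta_max_derivatives[OF this] obtain h where fh: "\<And>e. e \<in> edges G \<Longrightarrow> H1_deriv (len G e) (f e) (h e)" by blast
    have "(LINT x|lebesgue_on {0..len G e}. (cmod (f e x))\<^sup>2) \<le> (c * \<rho>)\<^sup>2 * len G e" if e: "e \<in> edges G" for e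
    proof -
      have "(LINT x|lebesgue_on {0..len G e}. (cmod (f e x))\<^sup>2) \<le> (LINT x|lebesgue_on {0..len G e}. (c * \<rho>)\<^sup>2)"
      proof (rule Bochner_Integration.integral_mono)
        show "integrable (lebesgue_on {0..len G e}) (\<lambda>x. (cmod (f e x))\<^sup>2)"
          by (intro continuous_imp_integrable_real continuous_intros H1_deriv_continuous[OF fh[OF e]])
        show "(cmod (f e x))\<^sup>2 \<le> (c * \<rho>)\<^sup>2" if "x \<in> space (lebesgue_on {0..len G e})" for x
          using c[OF fg e, of x] that unfolding \<rho>_def by (intro power_mono) simp_all
      qed simp
      also have "\<dots> = (c * \<rho>)\<^sup>2 * len G e"
        using len_pos[OF e] by (simp add: measure_restrict_space)
      finally show ?thesis .
    qed
    then have "L2_norm G f \<le> sqrt (\<Sum>e\<in>edges G. (c * \<rho>)\<^sup>2 * len G e)"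
      unfolding L2_norm_def by (intro real_sqrt_le_mono sum_mono)
    also have "\<dots> = C * \<rho>"
      using c0 \<rho>0 by (simp add: C_def sum_distrib_left[symmetric] real_sqrt_mult abs_mult)
    finally show ?thesis unfolding eq \<rho>_def .
  qed
  show ?thesis
    unfolding resolvent_set_def
  proof (intro CollectI conjI ballI exI[of _ C])
    fix p assume "p \<in> neg_op (Delta G Vo)"
    then obtain f g where p: "p = (f, \<lambda>e x. - g e x)" and fg: "(f, g) \<in> Delta G Vo"
      unfolding neg_op_def by blast
    show "case p of (f, g) \<Rightarrow> L2_eq G (\<lambda>e x. ?z * f e x - g e x) (\<lambda>e x. 0) \<longrightarrow> L2_eq G f (\<lambda>e x. 0)"
      unfolding p split using inj[OF fg] by blast
    show "case p of (f, g) \<Rightarrow> L2_norm G f \<le> C * L2_norm G (\<lambda>e x. ?z * f e x - g e x)"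
      unfolding p split by (rule bdd[OF fg])
  next
    fix r assume "r \<in> L2_graph G"
    from surj[OF this] obtain f g where fg: "(f, g) \<in> Delta G Vo"
      "L2_eq G (\<lambda>e x. ?z * f e x - - g e x) r" by blast
    from fg(1) have "(f, \<lambda>e x. - g e x) \<in> neg_op (Delta G Vo)" unfolding neg_op_def by blast
    moreover have "case (f, \<lambda>e x. - g e x) of (f, g) \<Rightarrow> L2_eq G (\<lambda>e x. ?z * f e x - g e x) r"
      unfolding split by (rule fg(2))
    ultimately show "\<exists>p\<in>neg_op (Delta G Vo). case p of (f, g) \<Rightarrow> L2_eq G (\<lambda>e x. ?z * f e x - g e x) r" ..
  qed
qed


section \<open>The Dirichlet-to-Neumann semigroup\<close>

lemma DtN_solution_vertex_op:
  assumes S: "\<And>e. e \<in> edges G \<Longrightarrow> sin_sol lam (len G e) \<noteq> 0" and f: "DtN_solution G Vo lam x f"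
  shows "normal_deriv G f v = vertex_op G lam (vertex_trace G f) v"
proof -
  from f obtain g where g: "(f, g) \<in> Delta_max G"
    "L2_eq G (\<lambda>e t. g e t + complex_of_real lam * f e t) (\<lambda>e t. 0)" unfolding DtN_solution_def by blast
  from Delta_max_derivatives[OF g(1)] obtain h where
    fh: "\<And>e. e \<in> edges G \<Longrightarrow> H1_deriv (len G e) (f e) (h e)" and
    hg: "\<And>e. e \<in> edges G \<Longrightarrow> H1_deriv (len G e) (h e) (g e)" and c: "continuous_across_vertices G f" by blast
  have "sin_conv lam (len G e) (\<lambda>t. g e t + complex_of_real lam * f e t) = 0"
    "cos_conv lam (len G e) (\<lambda>t. g e t + complex_of_real lam * f e t) = 0" if "e \<in> edges G" for e
    using g(2) that by (auto simp: L2_eq_def intro!: convolution_AE_zero)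
  then have "boundary_defect G lam (\<lambda>e t. g e t + complex_of_real lam * f e t) v = 0"
    by (simp add: boundary_defect_def)
  then show ?thesis using normal_deriv_eq[OF fh hg c S] by simp
qed

text \<open>The vertex values \<open>y\<close> of the solution with outer values \<open>x\<close> are determined by a problem on the vertices
  alone, so the matrix of the Dirichlet-to-Neumann operator is the Schur complement of the inner block of the
  vertex operator.\<close>

lemma DtN_eq:
  assumes adm: "admissible G Vo lam" and yo: "\<And>v. v \<in> Vo \<Longrightarrow> y v = x v"
    and yi: "\<And>v. v \<in> Vi \<Longrightarrow> vertex_op G lam y v = 0" and v: "v \<in> verts G"
  shows "DtN G Vo lam x v = vertex_op G lam y v"
  unfolding DtN_def
proof (rule the_equality)
  have S0: "\<And>e. e \<in> edges G \<Longrightarrow> sin_sol lam (len G e) \<noteq> 0" using admissible_sin_sol[OF adm] by force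
  have 0: "(\<lambda>e t. 0) \<in> L2_graph G" by (auto simp: L2_graph_def intro!: L2_interval_continuous)
  have "\<exists>f h. (\<forall>e\<in>edges G. H1_deriv (len G e) (f e) (h e)) \<and>
    (\<forall>e\<in>edges G. H1_deriv (len G e) (h e) (\<lambda>t. 0 - complex_of_real lam * f e t)) \<and>
    continuous_across_vertices G f \<and> (\<forall>v\<in>verts G. vertex_trace G f v = y v)"
    by (rule extension_exists[OF 0]) (rule S0)
  then obtain f h where
    fh: "\<forall>e\<in>edges G. H1_deriv (len G e) (f e) (h e)" and
    hg: "\<forall>e\<in>edges G. H1_deriv (len G e) (h e) (\<lambda>t. 0 - complex_of_real lam * f e t)" and
    ca: "continuous_across_vertices G f" and tr: "\<forall>v\<in>verts G. vertex_trace G f v = y v"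
    by (elim exE conjE)
  note fh = fh[rule_format] and hg = hg[rule_format] and tr = tr[rule_format]
  have nd: "normal_deriv G f w = vertex_op G lam y w" if w: "w \<in> verts G" for w
  proof -
    have "boundary_defect G lam (\<lambda>e t. 0 - complex_of_real lam * f e t + complex_of_real lam * f e t) w = 0"
      by (simp add: boundary_defect_def sin_conv_def cos_conv_def)
    moreover have "vertex_op G lam (vertex_trace G f) w = vertex_op G lam y w"
      by (rule vertex_op_cong) (use tr w in simp_all)
    ultimately show ?thesis using normal_deriv_eq[OF fh hg ca S0] by simp
  qed
  have "DtN_solution G Vo lam x f"
    unfolding DtN_solution_def
  proof (intro conjI exI[of _ "\<lambda>e t. 0 - complex_of_real lam * f e t"] ballI)
    show "(f, \<lambda>e t. 0 - complex_of_real lam * f e t) \<in> Delta_max G" by (rule Delta_maxI[OF fh hg ca])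
    show "L2_eq G (\<lambda>e t. 0 - complex_of_real lam * f e t + complex_of_real lam * f e t) (\<lambda>e t. 0)"
      by (simp add: L2_eq_def)
    show "vertex_trace G f w = x w" if "w \<in> Vo" for w using that tr yo Vo_verts by auto
    show "normal_deriv G f w = 0" if "w \<in> Vi" for w using nd[of w] yi[OF that] that by simp
  qed
  with nd[OF v] show "\<exists>f. DtN_solution G Vo lam x f \<and> vertex_op G lam y v = normal_deriv G f v" by auto
  fix d assume "\<exists>f. DtN_solution G Vo lam x f \<and> d = normal_deriv G f v"
  then obtain f' where f': "DtN_solution G Vo lam x f'" and d: "d = normal_deriv G f' v" by blast
  note nd' = DtN_solution_vertex_op[OF S0 f']
  have "vertex_trace G f' w - y w = 0" if "w \<in> verts G" for w
  proof (rule admissible_injective_complex[OF adm _ _ that])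
    show "vertex_trace G f' u - y u = 0" if "u \<in> Vo" for u
      using f' yo[OF that] that by (simp add: DtN_solution_def)
    show "vertex_op G lam (\<lambda>u. vertex_trace G f' u - y u) u = 0" if "u \<in> Vi" for u
      unfolding vertex_op_diff using nd'[of u] f' yi[OF that] that by (simp add: DtN_solution_def)
  qed
  then have "vertex_op G lam (vertex_trace G f') v = vertex_op G lam y v"
    by (intro vertex_op_cong v) simp
  then show "d = vertex_op G lam y v" using nd' d by simp
qed

text \<open>Let \<open>Y v\<close> be the vertex values of the solution that is \<open>1\<close> at \<open>v\<close> and \<open>0\<close> at the other outer vertices. It is
  nonnegative by the maximum principle, so the entry \<open>D u v\<close> of the matrix, for \<open>u \<noteq> v\<close>, is not positive; it is
  negative if \<open>Y v\<close> is positive at a neighbour of \<open>u\<close>. Following a path in the graph, positivity of \<open>Y v\<close>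
  propagates through the inner vertices until an outer vertex is met, where a nonzero matrix entry leads on to
  the next column. Hence the matrix is irreducible.\<close>

lemma admissible_imp_strongly_positive:
  assumes adm: "admissible G Vo lam"
  shows "strongly_positive Vo (DtN_semigroup G Vo lam)"
proof -
  note S = admissible_sin_sol[OF adm]
  have "\<forall>v. \<exists>y :: 'v \<Rightarrow> real. (\<forall>w\<in>Vo. y w = (if w = v then 1 else 0)) \<and> (\<forall>w\<in>Vi. vertex_op G lam y w = 0)"
    by (intro allI admissible_solvable[OF adm])
  from choice[OF this] obtain Y :: "'v \<Rightarrow> 'v \<Rightarrow> real" where
    Y: "\<forall>v. (\<forall>w\<in>Vo. Y v w = (if w = v then 1 else 0)) \<and> (\<forall>w\<in>Vi. vertex_op G lam (Y v) w = 0)" ..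
  have Yo: "Y v w = (if w = v then 1 else 0)" if "w \<in> Vo" for v w using Y that by blast
  have Yi: "vertex_op G lam (Y v) w = 0" if "w \<in> Vi" for v w using Y that by blast
  have Ynn: "0 \<le> Y v w" if "w \<in> verts G" for v w
    by (rule comparison[OF adm _ _ that]) (simp_all only: Yo Yi, simp_all)
  define D where "D u v = vertex_op G lam (Y v) u" for u v
  have matrix: "DtN_matrix G Vo lam u v = complex_of_real (D u v)" if "u \<in> Vo" for u v
    unfolding DtN_matrix_def D_def vertex_op_of_real[symmetric]
  proof (rule DtN_eq[OF adm])
    show "complex_of_real (Y v w) = (if w = v then 1 else 0)" if "w \<in> Vo" for w by (simp add: Yo that)
    show "vertex_op G lam (\<lambda>u. complex_of_real (Y v u)) w = 0" if "w \<in> Vi" for w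
      unfolding vertex_op_of_real Yi[OF that] by simp
  qed (use that Vo_verts in blast)
  have off: "D u v \<le> 0" if "u \<in> Vo" "u \<noteq> v" for u v
    unfolding D_def by (rule vertex_op_nonpos[OF S Ynn]) (simp_all add: Yo that)
  let ?R = "{(a, b). a \<in> Vo \<and> b \<in> Vo \<and> a \<noteq> b \<and> D a b \<noteq> 0}"
  have path: "(u, v) \<in> ?R\<^sup>*" if u: "u \<in> Vo" and v: "v \<in> Vo" for u v
  proof -
    have "(v, w) \<in> {(a, b). {a, b} \<in> edges G}\<^sup>* \<Longrightarrow> \<exists>p\<in>Vo. (p, v) \<in> ?R\<^sup>* \<and> 0 < Y p w" for w
    proof (induction rule: rtrancl_induct)
      case base
      show ?case using v by (intro bexI[of _ v]) (simp_all add: Yo)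
    next
      case (step w w')
      then obtain p where p: "p \<in> Vo" "(p, v) \<in> ?R\<^sup>*" "0 < Y p w" by blast
      from step have "{w', w} \<in> edges G" by (simp add: insert_commute)
      from edge_opposite[OF this] have e: "{w', w} \<in> incident G w'" "opposite G {w', w} w' = w" by auto
      have w': "w' \<in> verts G" using \<open>{w', w} \<in> edges G\<close> edges_simple by blast
      show ?case
      proof (cases "0 < Y p w'")
        \<comment> \<open>A zero of \<open>Y p\<close> next to \<open>w\<close> cannot be an inner vertex, so \<open>w'\<close> is outer and can replace \<open>p\<close>.\<close>
        case False
        with Ynn[OF w', of p] have 0: "Y p w' = 0" by simp
        have neg: "D w' p < 0"
          unfolding D_def by (rule vertex_op_neg[where y = "Y p" and e = "{w', w}", OF S Ynn 0 e(1)]) (simp_all add: e(2) p(3))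
        then have "w' \<in> Vo" using Yi[of w' p] w' unfolding D_def by force
        moreover have "w' \<noteq> p" using 0 Yo[OF p(1), of p] by auto
        ultimately have "(w', p) \<in> ?R" using neg p(1) by simp
        with p(2) have "(w', v) \<in> ?R\<^sup>*" by (rule converse_rtrancl_into_rtrancl[rotated])
        with \<open>w' \<in> Vo\<close> show ?thesis by (intro bexI[of _ w']) (simp_all add: Yo)
      qed (use p in blast)
    qed
    from this[OF connected[of v u]] u v Vo_verts obtain p where "p \<in> Vo" "(p, v) \<in> ?R\<^sup>*" "0 < Y p u" by blast
    then show ?thesis using Yo[OF u, of p] by (auto split: if_splits)
  qed
  show ?thesis
    unfolding strongly_positive_def DtN_semigroup_def
  proof (intro allI impI ballI)
    fix t :: real and u v assume t: "0 < t" and uv: "u \<in> Vo" "v \<in> Vo"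
    show "matrix_exp Vo (\<lambda>u v. - complex_of_real t * DtN_matrix G Vo lam u v) u v \<in> \<real> \<and>
        0 < Re (matrix_exp Vo (\<lambda>u v. - complex_of_real t * DtN_matrix G Vo lam u v) u v)"
    proof (rule matrix_exp_pos_offdiagonal[where A = "\<lambda>u v. - t * D u v"])
      show "finite Vo" by (rule finite_subset[OF Vo_verts finite_verts])
      show "0 \<le> - t * D u v" if "u \<in> Vo" "v \<in> Vo" "u \<noteq> v" for u v
        using mult_nonneg_nonpos[OF less_imp_le[OF t] off[OF that(1,3)]] by simp
      show "(u, v) \<in> {(a, b). a \<in> Vo \<and> b \<in> Vo \<and> a \<noteq> b \<and> - t * D a b \<noteq> 0}\<^sup>*"
        using path[OF uv] t by simp
      show "- complex_of_real t * DtN_matrix G Vo lam u v = complex_of_real (- t * D u v)"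
        if "u \<in> Vo" "v \<in> Vo" for u v by (simp add: matrix that)
    qed (rule uv)+
  qed
qed


section \<open>The bottom of the spectrum\<close>

text \<open>A function that is nonzero at a single point of an edge is not a null function, because it is continuous
  there; so an eigenfunction in the pointwise sense violates injectivity of \<open>lam - A\<close>.\<close>

lemma eigenfunction_in_spectrum:
  assumes fg: "(f, \<lambda>e x. - (complex_of_real lam * f e x)) \<in> Delta G Vo"
    and e: "e \<in> edges G" and x: "x \<in> {0..len G e}" and nz: "f e x \<noteq> 0"
  shows "complex_of_real lam \<in> spectrum G (neg_op (Delta G Vo))"
  unfolding spectrum_def
proof
  let ?g = "\<lambda>e x. - (- (complex_of_real lam * f e x))"
  assume "complex_of_real lam \<in> resolvent_set G (neg_op (Delta G Vo))"
  then have inj: "\<forall>p\<in>neg_op (Delta G Vo). case p of (f, g) \<Rightarrow>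
      L2_eq G (\<lambda>e x. complex_of_real lam * f e x - g e x) (\<lambda>e x. 0) \<longrightarrow> L2_eq G f (\<lambda>e x. 0)"
    unfolding resolvent_set_def by (elim CollectE conjE)
  have "(f, ?g) \<in> neg_op (Delta G Vo)" by (rule neg_opI[OF fg])
  from bspec[OF inj this] have "L2_eq G f (\<lambda>e x. 0)"
    unfolding split by (rule mp) (simp add: L2_eq_def)
  then have ae: "AE x in lebesgue_on {0..len G e}. f e x = 0" using e by (simp add: L2_eq_def)
  from fg have "(f, \<lambda>e x. - (complex_of_real lam * f e x)) \<in> Delta_max G" by (simp add: Delta_def)
  from Delta_max_derivatives[OF this] obtain h where
    fh: "\<And>e. e \<in> edges G \<Longrightarrow> H1_deriv (len G e) (f e) (h e)" by blast
  from AE_zero_continuous[OF H1_deriv_continuous[OF fh[OF e]] len_pos[OF e] ae x] nz show False by simp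
qed

lemma singular_vertex_op_in_spectrum:
  assumes S: "\<And>e. e \<in> edges G \<Longrightarrow> sin_sol lam (len G e) \<noteq> 0"
    and yo: "\<And>v. v \<in> Vo \<Longrightarrow> y v = (0 :: real)" and yi: "\<And>v. v \<in> Vi \<Longrightarrow> vertex_op G lam y v = 0"
    and v: "v \<in> verts G" and nz: "y v \<noteq> 0"
  shows "complex_of_real lam \<in> spectrum G (neg_op (Delta G Vo))"
proof -
  have 0: "(\<lambda>e t. 0) \<in> L2_graph G" by (auto simp: L2_graph_def intro!: L2_interval_continuous)
  have "\<exists>f h. (\<forall>e\<in>edges G. H1_deriv (len G e) (f e) (h e)) \<and>
    (\<forall>e\<in>edges G. H1_deriv (len G e) (h e) (\<lambda>t. 0 - complex_of_real lam * f e t)) \<and>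
    continuous_across_vertices G f \<and> (\<forall>v\<in>verts G. vertex_trace G f v = complex_of_real (y v))"
    by (rule extension_exists[OF 0]) (rule S)
  then obtain f h where
    fh: "\<forall>e\<in>edges G. H1_deriv (len G e) (f e) (h e)" and
    hg: "\<forall>e\<in>edges G. H1_deriv (len G e) (h e) (\<lambda>t. 0 - complex_of_real lam * f e t)" and
    ca: "continuous_across_vertices G f" and tr: "\<forall>v\<in>verts G. vertex_trace G f v = complex_of_real (y v)"
    by (elim exE conjE)
  note fh = fh[rule_format] and tr = tr[rule_format]
  have hg: "H1_deriv (len G e) (h e) (\<lambda>t. - (complex_of_real lam * f e t))" if "e \<in> edges G" for e
    using hg that by simp
  have nd: "normal_deriv G f w = 0" if w: "w \<in> Vi" for w
  proof -
    have "normal_deriv G f w = vertex_op G lam (vertex_trace G f) w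
       + boundary_defect G lam (\<lambda>e t. - (complex_of_real lam * f e t) + complex_of_real lam * f e t) w"
      by (rule normal_deriv_eq[OF fh hg ca S])
    also have "boundary_defect G lam (\<lambda>e t. - (complex_of_real lam * f e t) + complex_of_real lam * f e t) w = 0"
      by (simp add: boundary_defect_def sin_conv_def cos_conv_def)
    also have "vertex_op G lam (vertex_trace G f) w = vertex_op G lam (\<lambda>v. complex_of_real (y v)) w"
      by (rule vertex_op_cong) (use tr w in simp_all)
    finally show ?thesis by (simp only: vertex_op_of_real yi[OF w] of_real_0 add_0)
  qed
  have fg: "(f, \<lambda>e t. - (complex_of_real lam * f e t)) \<in> Delta G Vo"
    unfolding Delta_def mem_Collect_eq split
  proof (intro conjI ballI)
    show "(f, \<lambda>e t. - (complex_of_real lam * f e t)) \<in> Delta_max G" by (rule Delta_maxI[OF fh hg ca])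
    show "vertex_trace G f w = 0" if "w \<in> Vo" for w using tr[of w] yo[OF that] that Vo_verts by auto
  qed (rule nd)
  obtain e where e: "e \<in> edges G" "v \<in> e" using incident_nonempty[OF v] by (auto simp: incident_def)
  have end_points: "0 \<in> {0..len G e}" "len G e \<in> {0..len G e}" using len_pos[OF e(1)] by simp_all
  have "vertex_trace G f v \<noteq> 0" using tr[OF v] nz by simp
  moreover from e(2) have "v = lend G e \<or> v = rend G e" unfolding in_edge_iff[OF e(1)] .
  ultimately have "f e 0 \<noteq> 0 \<or> f e (len G e) \<noteq> 0" using vertex_trace_eq[OF ca e(1)] by auto
  then show ?thesis
    using eigenfunction_in_spectrum[OF fg e(1) end_points(1)] eigenfunction_in_spectrum[OF fg e(1) end_points(2)]
    by (elim disjE)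
qed

text \<open>A sine on one edge, extended by zero, vanishes at the outer end points of that edge and contributes nothing
  to the normal derivative at inner vertices.\<close>

lemma Dirichlet_edge_in_spectrum:
  assumes e0: "e0 \<in> edges G" and S: "sin_sol lam (len G e0) = 0"
    and ends: "lend G e0 \<in> Vo" "rend G e0 \<in> Vo" and x: "x \<in> {0..len G e0}" and nz: "sin_sol lam x \<noteq> 0"
  shows "complex_of_real lam \<in> spectrum G (neg_op (Delta G Vo))"
proof -
  define f where "f e t = (if e = e0 then complex_of_real (sin_sol lam t) else 0)" for e t
  define h where "h e t = (if e = e0 then complex_of_real (cos_sol lam t) else 0)" for e t
  have dC: "(cos_sol lam has_real_derivative - lam * sin_sol lam t) (at t)" for t by (auto intro!: derivative_eq_intros)
  have dS: "(sin_sol lam has_real_derivative cos_sol lam t) (at t)" for t by (auto intro!: derivative_eq_intros)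
  have cC: "continuous_on UNIV (cos_sol lam)" and cS: "continuous_on UNIV (\<lambda>t. - lam * sin_sol lam t)"
    by (intro continuous_intros)+
  have fh: "H1_deriv (len G e) (f e) (h e)" for e
  proof (cases "e = e0")
    case True
    show ?thesis using H1_deriv_mult[OF H1_deriv_const[of "len G e" 1] dS cC]
      by (rule H1_deriv_cong) (simp_all add: f_def h_def True scaleR_conv_of_real)
  next
    case False
    show ?thesis using H1_deriv_const[of "len G e" 0] by (rule H1_deriv_cong) (simp_all add: f_def h_def False)
  qed
  have hg: "H1_deriv (len G e) (h e) (\<lambda>t. - (complex_of_real lam * f e t))" for e
  proof (cases "e = e0")
    case True
    show ?thesis using H1_deriv_mult[OF H1_deriv_const[of "len G e" 1] dC cS]
      by (rule H1_deriv_cong) (simp_all add: f_def h_def True scaleR_conv_of_real)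
  next
    case False
    show ?thesis using H1_deriv_const[of "len G e" 0] by (rule H1_deriv_cong) (simp_all add: f_def h_def False)
  qed
  have val: "vertex_value G f e v = 0" for e v using S by (simp add: vertex_value_def f_def)
  then have ca: "continuous_across_vertices G f" by (simp add: continuous_across_vertices_def)
  have fg: "(f, \<lambda>e t. - (complex_of_real lam * f e t)) \<in> Delta G Vo"
    unfolding Delta_def mem_Collect_eq split
  proof (intro conjI ballI)
    show "(f, \<lambda>e t. - (complex_of_real lam * f e t)) \<in> Delta_max G" by (rule Delta_maxI[OF fh hg ca])
    show "vertex_trace G f w = 0" if w: "w \<in> Vo" for w
    proof -
      have "w \<in> verts G" using w Vo_verts by blast
      from incident_nonempty[OF this] obtain e where "e \<in> edges G" "w \<in> e" by (auto simp: incident_def)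
      then show ?thesis unfolding vertex_trace_def val by (intro the_equality) auto
    qed
    show "normal_deriv G f w = 0" if "w \<in> Vi" for w
    proof -
      have "h e 0 = 0" if "lend G e = w" for e using that \<open>w \<in> Vi\<close> ends by (auto simp: h_def)
      moreover have "h e (len G e) = 0" if "rend G e = w" for e using that \<open>w \<in> Vi\<close> ends by (auto simp: h_def)
      ultimately show ?thesis unfolding normal_deriv_derivatives[OF fh hg] by simp
    qed
  qed
  have "f e0 x \<noteq> 0" using nz by (simp add: f_def)
  then show ?thesis by (rule eigenfunction_in_spectrum[OF fg e0 x])
qed

lemma isCont_vertex_op:
  assumes "\<And>e. e \<in> edges G \<Longrightarrow> sin_sol lam (len G e) \<noteq> 0"
  shows "isCont (\<lambda>lam. vertex_op G lam (x :: 'v \<Rightarrow> real) v) lam"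
  unfolding vertex_op_def
  by (intro continuous_intros isCont_cos_sol_param isCont_sin_sol_param) (use assms in \<open>auto simp: incident_def\<close>)

lemma eventually_pos_nhds:
  fixes \<phi> :: "real \<Rightarrow> real"
  assumes "isCont \<phi> a" "0 < \<phi> a" shows "eventually (\<lambda>t. 0 < \<phi> t) (nhds a)"
  using order_tendstoD(1)[of \<phi> "\<phi> a" "nhds a" 0] assms tendsto_at_iff_tendsto_nhds[of \<phi> a]
  by (simp add: isCont_def)

lemma eventually_nhds_left:
  assumes "eventually P (nhds (a :: real))" shows "\<exists>t<a. P t"
proof -
  from assms obtain d where d: "0 < d" "\<And>t. dist t a < d \<Longrightarrow> P t" unfolding eventually_nhds_metric by blast
  then have "P (a - d / 2)" by (intro d(2)) (simp add: dist_real_def)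
  with d(1) show ?thesis by (intro exI[of _ "a - d / 2"]) simp
qed

text \<open>The same supersolution works nearby, since finitely many strict inequalities persist.\<close>

lemma eventually_admissible:
  assumes adm: "admissible G Vo lam"
  shows "eventually (admissible G Vo) (nhds lam)"
proof -
  note S = admissible_sin_sol[OF adm]
  from adm obtain x :: "'v \<Rightarrow> real" where
    x: "\<And>v. v \<in> Vo \<Longrightarrow> x v = 0" "\<And>v. v \<in> Vi \<Longrightarrow> 0 < x v" "\<And>v. v \<in> Vi \<Longrightarrow> 0 < vertex_op G lam x v"
    unfolding admissible_def by blast
  have "eventually (\<lambda>lam. \<forall>e\<in>edges G. 0 < sin_sol lam (len G e)) (nhds lam)"
    by (intro eventually_ball_finite finite_edges ballI eventually_pos_nhds isCont_sin_sol_param S)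
  moreover have "eventually (\<lambda>lam. \<forall>v\<in>Vi. 0 < vertex_op G lam x v) (nhds lam)"
    using S by (intro eventually_ball_finite finite_Diff finite_verts ballI eventually_pos_nhds isCont_vertex_op x) force+
  ultimately show ?thesis
  proof eventually_elim
    case (elim l)
    then show ?case unfolding admissible_def using x by blast
  qed
qed

text \<open>For \<open>lam < 0\<close> the values \<open>cos_sol lam (len G e)\<close> exceed \<open>1\<close>, so the vertex operator is strictly diagonally
  dominant and the constant \<open>1\<close> on the inner vertices is a supersolution.\<close>

lemma admissible_negative:
  assumes neg: "lam < 0" shows "admissible G Vo lam"
proof -
  have S: "0 < sin_sol lam (len G e)" if "e \<in> edges G" for e
    using len_pos[OF that] neg by (simp add: sin_sol_def)
  have C: "1 < cos_sol lam (len G e)" if e: "e \<in> edges G" for e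
  proof (rule power2_less_imp_less)
    have "lam * (sin_sol lam (len G e))\<^sup>2 < 0" using neg S[OF e] by (intro mult_neg_pos) simp_all
    then show "1\<^sup>2 < (cos_sol lam (len G e))\<^sup>2" using cos_sol_sin_sol_squares[of lam "len G e"] by simp
    show "0 \<le> cos_sol lam (len G e)" using neg cosh_real_nonneg by (simp add: cos_sol_def)
  qed
  let ?x = "\<lambda>v. if v \<in> Vo then 0 else 1 :: real"
  have "0 < vertex_op G lam ?x v" if v: "v \<in> Vi" for v
    unfolding vertex_op_def
  proof (intro sum_pos finite_incident incident_nonempty)
    fix e assume "e \<in> incident G v"
    then have e: "e \<in> edges G" by (simp add: incident_def)
    have "?x (opposite G e v) < cos_sol lam (len G e) * ?x v" using C[OF e] v by auto
    then show "0 < (1 / sin_sol lam (len G e)) *\<^sub>R (cos_sol lam (len G e) *\<^sub>R ?x v - ?x (opposite G e v))"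
      using S[OF e] by simp
  qed (use v in simp)
  then show ?thesis unfolding admissible_def using S by (intro conjI ballI exI[of _ ?x]) auto
qed

text \<open>As \<open>l\<close> increases to \<open>lam\<close>, the diagonal entry at an inner vertex \<open>v\<close> tends to \<open>-\<infinity>\<close> if some edge at \<open>v\<close> has
  length \<open>pi / sqrt lam\<close>: there \<open>cos_sol\<close> tends to \<open>-1\<close> and \<open>sin_sol\<close> to \<open>0\<close> from above. But the diagonal entries of an
  M-matrix are positive.\<close>

lemma vertex_op_blow_up:
  assumes below: "\<And>l. l < lam \<Longrightarrow> admissible G Vo l" and lam: "0 < lam"
    and le: "\<And>e. e \<in> edges G \<Longrightarrow> sqrt lam * len G e \<le> pi"
    and e0: "e0 \<in> incident G v" and pi: "sqrt lam * len G e0 = pi" and v: "v \<in> Vi"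
  shows False
proof -
  \<comment> \<open>The diagonal entry at \<open>v\<close> times \<open>sin_sol l (len G e0)\<close>; the quotient of the sines is \<open>1\<close> for edges as long as
    \<open>e0\<close>, which keeps \<open>W\<close> continuous at \<open>lam\<close>.\<close>
  define W where "W l = (\<Sum>e\<in>incident G v. if len G e = len G e0 then cos_sol l (len G e0)
    else cos_sol l (len G e) / sin_sol l (len G e) * sin_sol l (len G e0))" for l
  have S: "sin_sol lam (len G e) \<noteq> 0" if "e \<in> edges G" "len G e \<noteq> len G e0" for e
  proof -
    have "sqrt lam * len G e \<noteq> pi" using that(2) pi lam by (metis mult_left_cancel real_sqrt_eq_zero_cancel_iff less_irrefl)
    with le[OF that(1)] have "sqrt lam * len G e < pi" by simp
    moreover have "0 < sqrt lam * len G e" using lam len_pos[OF that(1)] by simp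
    ultimately have "0 < sin (sqrt lam * len G e)" by (intro sin_gt_zero)
    then show ?thesis using lam by (simp add: sin_sol_def)
  qed
  have "isCont (\<lambda>l. if len G e = len G e0 then cos_sol l (len G e0)
      else cos_sol l (len G e) / sin_sol l (len G e) * sin_sol l (len G e0)) lam" if "e \<in> incident G v" for e
    using S[of e] that by (cases "len G e = len G e0")
      (auto simp: incident_def intro!: continuous_intros isCont_cos_sol_param isCont_sin_sol_param)
  then have "isCont (\<lambda>l. - W l) lam" unfolding W_def by (intro continuous_intros) 
  moreover have "0 < - W lam"
  proof -
    have C: "cos_sol lam (len G e0) = -1" and S0: "sin_sol lam (len G e0) = 0"
      using lam pi by (simp_all add: cos_sol_def sin_sol_def)
    have "- W lam = (\<Sum>e\<in>incident G v. if len G e = len G e0 then 1 else 0)"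
      unfolding W_def sum_negf[symmetric] by (intro sum.cong refl) (simp add: C S0)
    also have "\<dots> > 0" by (rule sum_pos2[OF finite_incident e0]) auto
    finally show ?thesis .
  qed
  ultimately have "eventually (\<lambda>l. 0 < - W l) (nhds lam)" by (rule eventually_pos_nhds)
  from eventually_nhds_left[OF this] obtain l where l: "l < lam" "W l < 0" by auto
  note adm = below[OF l(1)] and Sl = admissible_sin_sol[OF below[OF l(1)]]
  from adm obtain x :: "'v \<Rightarrow> real" where
    x: "\<And>v. v \<in> Vo \<Longrightarrow> x v = 0" "\<And>v. v \<in> Vi \<Longrightarrow> 0 < x v" "\<And>v. v \<in> Vi \<Longrightarrow> 0 < vertex_op G l x v"
    unfolding admissible_def by blast
  have xnn: "0 \<le> x w" if "w \<in> verts G" for w using x(1,2)[of w] that by (cases "w \<in> Vo") auto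
  have s0: "0 < sin_sol l (len G e0)" using Sl e0 by (simp add: incident_def)
  have "vertex_op G l x v \<le> (\<Sum>e\<in>incident G v. cos_sol l (len G e) / sin_sol l (len G e) * x v)"
    unfolding vertex_op_def
  proof (rule sum_mono)
    fix e assume e: "e \<in> incident G v"
    have "0 < sin_sol l (len G e)" using Sl e by (simp add: incident_def)
    then show "(1 / sin_sol l (len G e)) *\<^sub>R (cos_sol l (len G e) *\<^sub>R x v - x (opposite G e v))
      \<le> cos_sol l (len G e) / sin_sol l (len G e) * x v"
      using xnn[OF opposite_in_verts[OF e]] by (simp add: divide_right_mono)
  qed
  with x(3)[OF v] have "0 < (\<Sum>e\<in>incident G v. cos_sol l (len G e) / sin_sol l (len G e)) * x v"
    by (simp add: sum_distrib_right)
  with x(2)[OF v] have "0 < (\<Sum>e\<in>incident G v. cos_sol l (len G e) / sin_sol l (len G e))"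
    by (simp add: zero_less_mult_iff)
  with s0 have "0 < (\<Sum>e\<in>incident G v. cos_sol l (len G e) / sin_sol l (len G e)) * sin_sol l (len G e0)"
    by simp
  also have "\<dots> = W l"
    unfolding W_def sum_distrib_right using s0 by (intro sum.cong refl) simp
  finally show False using l(2) by simp
qed

text \<open>Let \<open>ls\<close> be the infimum of all parameters that are not admissible. It is not admissible, by openness, and either
  way in which admissibility can fail produces an eigenfunction.\<close>

theorem spectrum_bottom:
  obtains ls where "complex_of_real ls \<in> spectrum G (neg_op (Delta G Vo))" "\<And>l. l < ls \<Longrightarrow> admissible G Vo l"
proof -
  define B where "B = {l. \<not> admissible G Vo l}"
  define ls where "ls = Inf B"
  have B_ge: "0 \<le> l" if "l \<in> B" for l using that admissible_negative[of l] unfolding B_def by (cases "l < 0") auto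
  then have bdd: "bdd_below B" by (rule bdd_belowI)
  \<comment> \<open>At these parameters \<open>sin_sol\<close> vanishes at the end of \<open>e\<close>. So \<open>ls\<close> is at most \<open>(pi / len G e)\<^sup>2\<close> for every edge.\<close>
  have in_B: "(pi / len G e)\<^sup>2 \<in> B" if e: "e \<in> edges G" for e
    using admissible_sin_sol[OF _ e, of "(pi / len G e)\<^sup>2"] len_pos[OF e]
    by (auto simp: B_def sin_sol_def)
  obtain e1 where e1: "e1 \<in> edges G" using edges_nonempty by blast
  from in_B[OF e1] have ne: "B \<noteq> {}" by blast
  have below: "admissible G Vo l" if "l < ls" for l
    using that cInf_lower[OF _ bdd, of l] by (auto simp: ls_def B_def)
  have nadm: "\<not> admissible G Vo ls"
  proof
    assume "admissible G Vo ls"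
    from eventually_admissible[OF this] obtain d where
      d: "0 < d" "\<And>l. dist l ls < d \<Longrightarrow> admissible G Vo l" unfolding eventually_nhds_metric by blast
    have "ls + d \<le> l" if "l \<in> B" for l
    proof (rule ccontr)
      assume "\<not> ls + d \<le> l"
      moreover have "ls \<le> l" unfolding ls_def by (rule cInf_lower[OF that bdd])
      ultimately have "dist l ls < d" by (simp add: dist_real_def)
      with d(2) that show False by (auto simp: B_def)
    qed
    then have "ls + d \<le> ls" unfolding ls_def[symmetric] using cInf_greatest[OF ne] by (metis ls_def)
    with d(1) show False by simp
  qed
  have "complex_of_real ls \<in> spectrum G (neg_op (Delta G Vo))"
  proof (cases "\<forall>e\<in>edges G. 0 < sin_sol ls (len G e)")
    case True
    then have S: "\<And>e. e \<in> edges G \<Longrightarrow> 0 < sin_sol ls (len G e)" by blast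
    then have S0: "\<And>e. e \<in> edges G \<Longrightarrow> sin_sol ls (len G e) \<noteq> 0" by force
    show ?thesis
    proof (rule ccontr)
      assume ns: "complex_of_real ls \<notin> spectrum G (neg_op (Delta G Vo))"
      have "\<exists>x :: 'v \<Rightarrow> real. (\<forall>v\<in>Vo. x v = 0) \<and> (\<forall>v\<in>Vi. vertex_op G ls x v = 1)"
      proof (rule vertex_problem_solvable)
        fix y :: "'v \<Rightarrow> real"
        assume "\<And>v. v \<in> Vo \<Longrightarrow> y v = 0" "\<And>v. v \<in> Vi \<Longrightarrow> vertex_op G ls y v = 0"
        from singular_vertex_op_in_spectrum[OF S0 this] ns show "\<forall>v\<in>Vi. y v = 0" by blast
      qed
      then obtain x :: "'v \<Rightarrow> real" where xo: "\<And>v. v \<in> Vo \<Longrightarrow> x v = 0"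
        and xi: "\<And>v. v \<in> Vi \<Longrightarrow> vertex_op G ls x v = 1" by blast
      have "eventually (\<lambda>l. \<forall>v\<in>Vi. 0 < vertex_op G l x v) (nhds ls)"
        by (intro eventually_ball_finite finite_Diff finite_verts ballI eventually_pos_nhds isCont_vertex_op S0)
          (simp_all add: xi)
      \<comment> \<open>By continuity \<open>x\<close> is also a solution of a strict inequality at some admissible \<open>l < ls\<close>, so the maximum
        principle at \<open>l\<close> applies to it.\<close>
      from eventually_nhds_left[OF this] obtain l where
        l: "l < ls" "\<And>v. v \<in> Vi \<Longrightarrow> 0 < vertex_op G l x v" by blast
      have xnn: "0 \<le> x v" if "v \<in> verts G" for v
        by (rule comparison[OF below[OF l(1)] _ _ that]) (simp_all add: xo l(2) less_imp_le)
      have "0 < x v" if v: "v \<in> Vi" for v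
      proof (rule ccontr)
        assume "\<not> 0 < x v"
        with xnn[of v] v have "x v = 0" by simp
        from vertex_op_nonpos[where y = x, OF S xnn this] xi[OF v] show False by simp
      qed
      then have "admissible G Vo ls" unfolding admissible_def using S xo xi by (intro conjI ballI exI[of _ x]) auto
      with nadm show False ..
    qed
  next
    case False
    then obtain e0 where e0: "e0 \<in> edges G" and neg: "sin_sol ls (len G e0) \<le> 0" by (auto simp: not_less)
    have pos: "0 < ls"
    proof (rule ccontr)
      assume "\<not> 0 < ls"
      then have "0 < sin_sol ls (len G e0)" using len_pos[OF e0] by (auto simp: sin_sol_def)
      with neg show False by simp
    qed
    have le: "sqrt ls * len G e \<le> pi" if e: "e \<in> edges G" for e
    proof -
      have "ls \<le> (pi / len G e)\<^sup>2" unfolding ls_def by (rule cInf_lower[OF in_B[OF e] bdd])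
      then have "sqrt ls \<le> pi / len G e" using len_pos[OF e] by (intro real_le_lsqrt) simp_all
      then show ?thesis using len_pos[OF e] by (simp add: pos_le_divide_eq)
    qed
    have pi: "sqrt ls * len G e0 = pi"
    proof (rule ccontr)
      assume "sqrt ls * len G e0 \<noteq> pi"
      with le[OF e0] have "sqrt ls * len G e0 < pi" by simp
      then have "0 < sin (sqrt ls * len G e0)" using pos len_pos[OF e0] by (intro sin_gt_zero) simp_all
      then show False using neg pos by (simp add: sin_sol_def divide_le_0_iff)
    qed
    have outer: "w \<in> Vo" if "w \<in> e0" for w
    proof (rule ccontr)
      assume "w \<notin> Vo"
      moreover have "w \<in> verts G" using edges_simple[OF e0] that by blast
      ultimately show False
        using vertex_op_blow_up[OF below pos le _ pi, of w] e0 that by (simp add: incident_def)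
    qed
    show ?thesis
    proof (rule Dirichlet_edge_in_spectrum[OF e0])
      show "sin_sol ls (len G e0) = 0" using pi pos by (simp add: sin_sol_def)
      show "lend G e0 \<in> Vo" "rend G e0 \<in> Vo" using outer in_edge_iff[OF e0] by auto
      \<comment> \<open>The eigenfunction has its maximum at the midpoint.\<close>
      show "len G e0 / 2 \<in> {0..len G e0}" using len_pos[OF e0] by simp
      have "sqrt ls * (len G e0 / 2) = pi / 2" using pi by simp
      then show "sin_sol ls (len G e0 / 2) \<noteq> 0" using pos by (simp add: sin_sol_def)
    qed
  qed
  with below show ?thesis by (rule that[rotated])
qed

text \<open>The number \<open>ls\<close> of \<open>spectrum_bottom\<close> is the least real number in the spectrum, because all smaller ones are in the
  resolvent set.\<close>

lemma admissible_less_lambda1: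
  assumes "l < lambda1 G Vo" shows "admissible G Vo l"
proof -
  obtain ls where ls: "complex_of_real ls \<in> spectrum G (neg_op (Delta G Vo))"
    and below: "\<And>l. l < ls \<Longrightarrow> admissible G Vo l" using spectrum_bottom by blast
  have "lambda1 G Vo = ls"
    unfolding lambda1_def
  proof (rule Least_equality)
    show "complex_of_real ls \<in> spectrum G (neg_op (Delta G Vo))" by (rule ls)
    fix m assume "complex_of_real m \<in> spectrum G (neg_op (Delta G Vo))"
    then show "ls \<le> m" using below[of m] admissible_imp_resolvent[of m] unfolding spectrum_def by force
  qed
  with assms below show ?thesis by simp
qed


section \<open>Commensurable lengths\<close>

text \<open>The shift changes \<open>sqrt \<mu> * len G e\<close> by an integer multiple of \<open>2 * pi\<close>. So it preserves \<open>cos_sol\<close> and multiplies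
  \<open>sin_sol\<close> by \<open>sqrt \<mu> / k\<close> on all edges at once; the vertex operator is multiplied by the reciprocal factor.\<close>

lemma admissible_shift:
  fixes n :: "'v set \<Rightarrow> nat" and p :: nat
  assumes adm: "admissible G Vo \<mu>" and \<mu>: "0 < \<mu>" and L: "0 < L"
    and n: "\<And>e. e \<in> edges G \<Longrightarrow> real (n e) * L = len G e"
  shows "admissible G Vo ((sqrt \<mu> + 2 * pi * real p / L)\<^sup>2)"
proof -
  define k where "k = sqrt \<mu> + 2 * pi * real p / L"
  have k: "0 < k" using \<mu> L by (simp add: k_def add_pos_nonneg)
  have kl: "k * len G e = sqrt \<mu> * len G e + real (n e * p) * (2 * pi)" if e: "e \<in> edges G" for e
    using L n[OF e, symmetric] by (simp add: k_def field_simps)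
  have C: "cos_sol (k\<^sup>2) (len G e) = cos_sol \<mu> (len G e)" if e: "e \<in> edges G" for e
    using k \<mu> kl[OF e] cos.plus_of_nat[of "sqrt \<mu> * len G e" "n e * p"] by (simp add: cos_sol_def)
  have S: "sin_sol (k\<^sup>2) (len G e) = sqrt \<mu> / k * sin_sol \<mu> (len G e)" if e: "e \<in> edges G" for e
    using k \<mu> kl[OF e] sin.plus_of_nat[of "sqrt \<mu> * len G e" "n e * p"] by (simp add: sin_sol_def)
  have op: "vertex_op G (k\<^sup>2) x v = k / sqrt \<mu> * vertex_op G \<mu> x v" for x :: "'v \<Rightarrow> real" and v
    unfolding vertex_op_def sum_distrib_left
    by (intro sum.cong refl) (simp add: incident_def C S)
  from adm obtain x :: "'v \<Rightarrow> real" where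
    x: "\<And>v. v \<in> Vo \<Longrightarrow> x v = 0" "\<And>v. v \<in> Vi \<Longrightarrow> 0 < x v" "\<And>v. v \<in> Vi \<Longrightarrow> 0 < vertex_op G \<mu> x v"
    unfolding admissible_def by blast
  have "admissible G Vo (k\<^sup>2)"
    unfolding admissible_def
  proof (intro conjI ballI exI[of _ x])
    show "0 < sin_sol (k\<^sup>2) (len G e)" if "e \<in> edges G" for e
      using S[OF that] admissible_sin_sol[OF adm that] k \<mu> by simp
    show "0 < vertex_op G (k\<^sup>2) x v" if "v \<in> Vi" for v
      unfolding op using x(3)[OF that] k \<mu> by simp
  qed (use x in simp_all)
  then show ?thesis by (simp add: k_def)
qed

end

theorem theorem1p5:
  fixes G :: "'v quantum_graph" and Vo :: "'v set"
  assumes "connected_quantum_graph G"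
    and "Vo \<noteq> {}" and "Vo \<subseteq> verts G"
    and "commensurable (edges G) (len G)"
  shows "\<exists>L>0. \<forall>lam \<in> {(sqrt \<mu> + 2 * pi * real p / L)\<^sup>2 | (\<mu> :: real) (p :: nat).
             \<mu> \<in> {0<..<lambda1 G Vo} \<and> 1 \<le> p}.
           complex_of_real lam \<notin> spectrum G (neg_op (Delta G Vo)) \<and>
           strongly_positive Vo (DtN_semigroup G Vo lam)"
proof -
  interpret connected_quantum_graph G by fact
  interpret outer_vertices G Vo by unfold_locales fact
  from assms(4) obtain n :: "'v set \<Rightarrow> nat" and L :: real where L: "0 < L"
    and n: "\<And>e. e \<in> edges G \<Longrightarrow> real (n e) * L = len G e"
    unfolding commensurable_def by blast
  show ?thesis
  proof (intro exI[of _ L] conjI ballI L)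
    fix lam assume "lam \<in> {(sqrt \<mu> + 2 * pi * real p / L)\<^sup>2 | (\<mu> :: real) (p :: nat).
             \<mu> \<in> {0<..<lambda1 G Vo} \<and> 1 \<le> p}"
    then obtain \<mu> :: real and p :: nat where lam: "lam = (sqrt \<mu> + 2 * pi * real p / L)\<^sup>2"
      and \<mu>: "0 < \<mu>" "\<mu> < lambda1 G Vo" by auto
    have adm: "admissible G Vo lam"
      unfolding lam by (rule admissible_shift[OF admissible_less_lambda1[OF \<mu>(2)] \<mu>(1) L n])
    from admissible_imp_resolvent[OF adm] show "complex_of_real lam \<notin> spectrum G (neg_op (Delta G Vo))"
      by (simp add: spectrum_def)
    show "strongly_positive Vo (DtN_semigroup G Vo lam)" by (rule admissible_imp_strongly_positive[OF adm])
  qed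
qed

end
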